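(* Let $\mathbb{F}$ be an arbitrary field and let $I$ be an infinite set. For any automorphism $\varphi$ of the Lie algebra $L=\mathfrak{sl}_{\infty}(I,\mathbb{F})$ there exists $x\in GL_{rcf}(I,\mathbb{F})$ such that either $\varphi(a)=x^{-1}ax$ for all $a\in L$, or $\varphi(a)=-x^{-1}a^tx$ for all $a\in L$, where $a^t$ denotes the transpose of $a$.
   Context: $M_\infty(I,\mathbb{F})$ is the algebra of $I\times I$ matrices over $\mathbb{F}$ having only finitely many nonzero entries. $\mathfrak{sl}_\infty(I,\mathbb{F})=[M_\infty(I,\mathbb{F}),M_\infty(I,\mathbb{F})]$ is the Lie algebra spanned by the commutators $[a,b]=ab-ba$, $a,b\in M_\infty(I,\mathbb{F})$. $M_{rcf}(I,\mathbb{F})$ is the algebra of $I\times I$ matrices over $\mathbb{F}$ having finitely many nonzero entries in each row and in each column, and $GL_{rcf}(I,\mathbb{F})$ is the group of invertible elements of $M_{rcf}(I,\mathbb{F})$. *)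

theory Defs
  imports Complex_Main "HOL-Library.Function_Algebras" "HOL-Library.Groups_Big_Fun" "HOL-Algebra.Group"
begin

text \<open>
  An \<open>I \<times> I\<close> matrix is a function of two indices that vanishes outside \<open>I \<times> I\<close>; addition,
  subtraction and negation are the pointwise operations on functions.
\<close>

type_synonym ('i, 'f) mat = "'i \<Rightarrow> 'i \<Rightarrow> 'f"

definition M_fin :: "'i set \<Rightarrow> ('i, 'f::field) mat set" where
  "M_fin I = {a. {(i, j). a i j \<noteq> 0} \<subseteq> I \<times> I \<and> finite {(i, j). a i j \<noteq> 0}}"

definition M_rcf :: "'i set \<Rightarrow> ('i, 'f::field) mat set" where
  "M_rcf I = {a. {(i, j). a i j \<noteq> 0} \<subseteq> I \<times> I \<and>
     (\<forall>i\<in>I. finite {j. a i j \<noteq> 0}) \<and> (\<forall>j\<in>I. finite {i. a i j \<noteq> 0})}"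

text \<open>
  \<^const>\<open>Sum_any\<close> sums over the support of the summand. That support is finite whenever both
  factors are row- and column-finite, the only case in which the product is used.
\<close>

definition mat_mult :: "('i, 'f::field) mat \<Rightarrow> ('i, 'f) mat \<Rightarrow> ('i, 'f) mat" (infixl "\<star>" 70) where
  "a \<star> b = (\<lambda>i j. Sum_any (\<lambda>k. a i k * b k j))"

definition mat_one :: "'i set \<Rightarrow> ('i, 'f::field) mat" where
  "mat_one I = (\<lambda>i j. if i = j \<and> i \<in> I then 1 else 0)"

definition mat_scale :: "'f::field \<Rightarrow> ('i, 'f) mat \<Rightarrow> ('i, 'f) mat" where
  "mat_scale c a = (\<lambda>i j. c * a i j)"

definition mat_transpose :: "('i, 'f) mat \<Rightarrow> ('i, 'f) mat" where
  "mat_transpose a = (\<lambda>i j. a j i)"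

definition lie_bracket :: "('i, 'f::field) mat \<Rightarrow> ('i, 'f) mat \<Rightarrow> ('i, 'f) mat" where
  "lie_bracket a b = a \<star> b - b \<star> a"

interpretation mat: vector_space mat_scale
  by unfold_locales (auto simp: mat_scale_def fun_eq_iff algebra_simps)

definition sl_inf :: "'i set \<Rightarrow> ('i, 'f::field) mat set" where
  "sl_inf I = mat.span {lie_bracket a b | a b. a \<in> M_fin I \<and> b \<in> M_fin I}"

text \<open>Only the values of \<open>\<phi>\<close> on \<open>L\<close> matter.\<close>

definition lie_automorphism ::
    "('i, 'f::field) mat set \<Rightarrow> (('i, 'f) mat \<Rightarrow> ('i, 'f) mat) \<Rightarrow> bool" where
  "lie_automorphism L \<phi> \<longleftrightarrow> bij_betw \<phi> L L \<and>
     (\<forall>a\<in>L. \<forall>b\<in>L. \<phi> (a + b) = \<phi> a + \<phi> b) \<and>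
     (\<forall>c. \<forall>a\<in>L. \<phi> (mat_scale c a) = mat_scale c (\<phi> a)) \<and>
     (\<forall>a\<in>L. \<forall>b\<in>L. \<phi> (lie_bracket a b) = lie_bracket (\<phi> a) (\<phi> b))"

definition rcf_monoid :: "'i set \<Rightarrow> ('i, 'f::field) mat monoid" where
  "rcf_monoid I = \<lparr>carrier = M_rcf I, mult = mat_mult, one = mat_one I\<rparr>"

definition GL_rcf :: "'i set \<Rightarrow> ('i, 'f::field) mat monoid" where
  "GL_rcf I = units_of (rcf_monoid I)"

lemma M_rcf_D:
  assumes "a \<in> M_rcf I"
  shows "a i j \<noteq> 0 \<Longrightarrow> i \<in> I \<and> j \<in> I"
    and "finite {j. a i j \<noteq> 0}" and "finite {i. a i j \<noteq> 0}"
proof -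
  show *: "i \<in> I \<and> j \<in> I" if "a i j \<noteq> 0" for i j
    using assms that by (auto simp: M_rcf_def)
  show "finite {j. a i j \<noteq> 0}"
  proof (cases "i \<in> I")
    case False
    then have "{j. a i j \<noteq> 0} = {}" using * by blast
    then show ?thesis by simp
  qed (use assms in \<open>auto simp: M_rcf_def\<close>)
  show "finite {i. a i j \<noteq> 0}"
  proof (cases "j \<in> I")
    case False
    then have "{i. a i j \<noteq> 0} = {}" using * by blast
    then show ?thesis by simp
  qed (use assms in \<open>auto simp: M_rcf_def\<close>)
qed

lemma M_rcf_I:
  assumes "\<And>i j. a i j \<noteq> 0 \<Longrightarrow> i \<in> I \<and> j \<in> I"
    and "\<And>i. finite {j. a i j \<noteq> 0}" and "\<And>j. finite {i. a i j \<noteq> 0}"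
  shows "a \<in> M_rcf I"
  using assms by (auto simp: M_rcf_def)

lemma M_fin_subset_M_rcf: "M_fin I \<subseteq> M_rcf I"
proof
  fix a :: "('a, 'b) mat" assume a: "a \<in> M_fin I"
  then have fin: "finite {(i, j). a i j \<noteq> 0}" by (simp add: M_fin_def)
  show "a \<in> M_rcf I"
  proof (rule M_rcf_I)
    show "i \<in> I \<and> j \<in> I" if "a i j \<noteq> 0" for i j using a that by (auto simp: M_fin_def)
    show "finite {j. a i j \<noteq> 0}" for i
      by (rule finite_subset[OF _ finite_imageI[OF fin, of snd]]) force
    show "finite {i. a i j \<noteq> 0}" for j
      by (rule finite_subset[OF _ finite_imageI[OF fin, of fst]]) force
  qed
qed

lemma mat_mult_eq_sum:
  assumes "finite A" and "\<And>k. a i k * b k j \<noteq> 0 \<Longrightarrow> k \<in> A"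
  shows "(a \<star> b) i j = (\<Sum>k\<in>A. a i k * b k j)"
  unfolding mat_mult_def by (rule Sum_any.expand_superset) (use assms in auto)

lemma mat_mult_nonzeroE:
  assumes "(a \<star> b) i j \<noteq> 0"
  obtains k where "a i k \<noteq> 0" "b k j \<noteq> 0"
proof -
  have "\<exists>k. a i k * b k j \<noteq> 0"
  proof (rule ccontr)
    assume "\<nexists>k. a i k * b k j \<noteq> 0"
    then have "(a \<star> b) i j = (\<Sum>k\<in>{}. a i k * b k j)"
      by (intro mat_mult_eq_sum) auto
    with assms show False by simp
  qed
  then show ?thesis using that by auto
qed

lemma M_rcf_mult_closed:
  assumes "a \<in> M_rcf I" "b \<in> M_rcf I"
  shows "a \<star> b \<in> M_rcf I"
proof (rule M_rcf_I)
  show "i \<in> I \<and> j \<in> I" if "(a \<star> b) i j \<noteq> 0" for i j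
    using that assms[THEN M_rcf_D(1)] by (elim mat_mult_nonzeroE) blast
  show "finite {j. (a \<star> b) i j \<noteq> 0}" for i
  proof (rule finite_subset)
    show "{j. (a \<star> b) i j \<noteq> 0} \<subseteq> (\<Union>k\<in>{k. a i k \<noteq> 0}. {j. b k j \<noteq> 0})"
      by (auto elim: mat_mult_nonzeroE)
    show "finite (\<Union>k\<in>{k. a i k \<noteq> 0}. {j. b k j \<noteq> 0})"
      by (intro finite_UN_I M_rcf_D(2)[OF assms(1)] M_rcf_D(2)[OF assms(2)])
  qed
  show "finite {i. (a \<star> b) i j \<noteq> 0}" for j
  proof (rule finite_subset)
    show "{i. (a \<star> b) i j \<noteq> 0} \<subseteq> (\<Union>k\<in>{k. b k j \<noteq> 0}. {i. a i k \<noteq> 0})"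
      by (auto elim: mat_mult_nonzeroE)
    show "finite (\<Union>k\<in>{k. b k j \<noteq> 0}. {i. a i k \<noteq> 0})"
      by (intro finite_UN_I M_rcf_D(3)[OF assms(1)] M_rcf_D(3)[OF assms(2)])
  qed
qed

lemma mat_mult_assoc:
  assumes a: "a \<in> M_rcf I" and c: "c \<in> M_rcf J"
  shows "(a \<star> b) \<star> c = a \<star> (b \<star> c)"
proof (intro ext)
  fix i l
  let ?S = "{j. a i j \<noteq> 0}" and ?T = "{k. c k l \<noteq> 0}"
  have S: "finite ?S" and T: "finite ?T" by (rule M_rcf_D(2)[OF a], rule M_rcf_D(3)[OF c])
  have ab: "(a \<star> b) i k = (\<Sum>j\<in>?S. a i j * b j k)" for k
    by (rule mat_mult_eq_sum[OF S]) auto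
  have bc: "(b \<star> c) j l = (\<Sum>k\<in>?T. b j k * c k l)" for j
    by (rule mat_mult_eq_sum[OF T]) auto
  have "((a \<star> b) \<star> c) i l = (\<Sum>k\<in>?T. (a \<star> b) i k * c k l)"
    by (rule mat_mult_eq_sum[OF T]) auto
  also have "\<dots> = (\<Sum>j\<in>?S. \<Sum>k\<in>?T. a i j * b j k * c k l)"
    unfolding ab sum_distrib_right by (rule sum.swap)
  also have "\<dots> = (\<Sum>j\<in>?S. a i j * (b \<star> c) j l)"
    unfolding bc sum_distrib_left by (simp add: mult.assoc)
  also have "\<dots> = (a \<star> (b \<star> c)) i l"
    by (rule mat_mult_eq_sum[OF S, symmetric]) auto
  finally show "((a \<star> b) \<star> c) i l = (a \<star> (b \<star> c)) i l" .
qed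

lemma mat_one_in_M_rcf: "mat_one I \<in> M_rcf I"
proof (rule M_rcf_I)
  show "finite {j. (mat_one I :: ('a, 'b) mat) i j \<noteq> 0}" for i
    by (rule finite_subset[of _ "{i}"]) (auto simp: mat_one_def)
  show "finite {i. (mat_one I :: ('a, 'b) mat) i j \<noteq> 0}" for j
    by (rule finite_subset[of _ "{j}"]) (auto simp: mat_one_def)
qed (auto simp: mat_one_def split: if_splits)

lemma mat_one_left:
  assumes "a \<in> M_rcf I" shows "mat_one I \<star> a = a"
proof (intro ext)
  fix i j
  have "(mat_one I \<star> a) i j = (\<Sum>k\<in>{i}. mat_one I i k * a k j)"
    by (rule mat_mult_eq_sum) (auto simp: mat_one_def split: if_splits)
  then show "(mat_one I \<star> a) i j = a i j"
    using M_rcf_D(1)[OF assms, of i j] by (auto simp: mat_one_def)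
qed

lemma mat_one_right:
  assumes "a \<in> M_rcf I" shows "a \<star> mat_one I = a"
proof (intro ext)
  fix i j
  have "(a \<star> mat_one I) i j = (\<Sum>k\<in>{j}. a i k * mat_one I k j)"
    by (rule mat_mult_eq_sum) (auto simp: mat_one_def split: if_splits)
  then show "(a \<star> mat_one I) i j = a i j"
    using M_rcf_D(1)[OF assms, of i j] by (auto simp: mat_one_def)
qed

lemma monoid_rcf_monoid: "Group.monoid (rcf_monoid I)"
  by (rule monoidI)
    (simp_all add: rcf_monoid_def M_rcf_mult_closed mat_one_in_M_rcf mat_mult_assoc[of _ I _ I]
      mat_one_left mat_one_right)

lemma group_GL_rcf: "Group.group (GL_rcf I)"
  unfolding GL_rcf_def by (rule monoid.units_group[OF monoid_rcf_monoid])

lemma M_fin_I: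
  assumes "\<And>i j. a i j \<noteq> 0 \<Longrightarrow> (i, j) \<in> S" and "finite S" and "S \<subseteq> I \<times> I"
  shows "a \<in> M_fin I"
proof -
  have "{(i, j). a i j \<noteq> 0} \<subseteq> S" using assms(1) by auto
  then show ?thesis using assms(2,3) by (simp add: M_fin_def finite_subset)
qed

lemma M_fin_mult_closed:
  assumes "a \<in> M_fin I" "b \<in> M_fin I"
  shows "a \<star> b \<in> M_fin I"
proof (rule M_fin_I)
  let ?A = "{(i, j). a i j \<noteq> 0}" and ?B = "{(i, j). b i j \<noteq> 0}"
  show "(i, j) \<in> fst ` ?A \<times> snd ` ?B" if nz: "(a \<star> b) i j \<noteq> 0" for i j
  proof -
    obtain k where "(i, k) \<in> ?A" "(k, j) \<in> ?B" using mat_mult_nonzeroE[OF nz] by auto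
    then show ?thesis by (metis SigmaI fst_conv snd_conv imageI)
  qed
  show "finite (fst ` ?A \<times> snd ` ?B)" using assms by (simp add: M_fin_def)
  show "fst ` ?A \<times> snd ` ?B \<subseteq> I \<times> I" using assms by (auto simp: M_fin_def)
qed

lemma subspace_M_fin: "mat.subspace (M_fin I :: ('i, 'f::field) mat set)"
proof (rule mat.subspaceI)
  show "(0 :: ('i, 'f) mat) \<in> M_fin I" by (simp add: M_fin_def)
  show "a + b \<in> M_fin I" if "a \<in> M_fin I" "b \<in> M_fin I" for a b :: "('i, 'f) mat"
    by (rule M_fin_I[where S = "{(i, j). a i j \<noteq> 0} \<union> {(i, j). b i j \<noteq> 0}"])
      (use that in \<open>auto simp: M_fin_def\<close>)
  show "mat_scale c a \<in> M_fin I" if "a \<in> M_fin I" for c and a :: "('i, 'f) mat"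
    by (rule M_fin_I[where S = "{(i, j). a i j \<noteq> 0}"])
      (use that in \<open>auto simp: M_fin_def mat_scale_def\<close>)
qed

lemma sl_inf_subset_M_fin: "sl_inf I \<subseteq> M_fin I"
proof -
  have "lie_bracket a b \<in> M_fin I" if "a \<in> M_fin I" "b \<in> M_fin I" for a b :: "('a, 'b) mat"
    unfolding lie_bracket_def
    by (intro mat.subspace_diff[OF subspace_M_fin] M_fin_mult_closed that)
  then show ?thesis
    unfolding sl_inf_def by (intro mat.span_minimal subspace_M_fin) auto
qed

lemma sl_inf_bracket_closed:
  assumes "a \<in> sl_inf I" "b \<in> sl_inf I"
  shows "lie_bracket a b \<in> sl_inf I"
proof -
  have "a \<in> M_fin I" "b \<in> M_fin I" using assms sl_inf_subset_M_fin by auto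
  then show ?thesis unfolding sl_inf_def by (intro mat.span_base) auto
qed

end

theory Submission
  imports Defs
begin

text \<open>
  The idea is to recognise the matrices of rank one inside the Lie algebra by commutation alone,
  in a way that is insensitive to the characteristic and to the size of the field. Quadratic
  conditions such as \<open>[b, [b, x]] \<in> F b\<close> degenerate in characteristic two. Instead, for \<open>a, b\<close> in
  \<open>L = sl_inf I\<close> let \<open>a\<close> be almost below \<open>b\<close> if the centralizer of \<open>b\<close> centralizes \<open>a\<close> up to finite
  codimension, that is, if \<open>[a, C(b)]\<close> has finite dimension. As \<open>I\<close> is infinite and \<open>b\<close> finitary,
  \<open>C(b)\<close> is, up to finite codimension, the set of all \<open>x\<close> with \<open>x b = b x = 0\<close>; hence \<open>a\<close> is almost
  below \<open>b\<close> exactly when the columns of \<open>a\<close> are combinations of columns of \<open>b\<close> and its rows are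
  combinations of rows of \<open>b\<close>. A nonzero \<open>b\<close> is minimal for this preorder precisely when it has
  rank one, because a \<open>b\<close> of higher rank has some \<open>b c b\<close> of rank one and trace zero below it.
  Being defined by the Lie structure, minimality is preserved by \<open>\<phi>\<close> (\<open>lie_minimal_automorphism\<close>).
  Two instances of the characterisation carry the proof: off-diagonal matrix units are minimal
  (\<open>lie_minimal_mat_unit\<close>), and minimal elements have rank one (\<open>lie_minimal_outer\<close>). Consequently
  \<open>\<phi> (E i j)\<close> has rank one for \<open>i \<noteq> j\<close>.

  For distinct \<open>i, j, k\<close> the image of \<open>E i k = [E i j, E j k]\<close> is a bracket of two rank-one
  matrices that again has rank one. This leaves two possibilities (\<open>image_unit_triangle\<close>):
  \<open>\<phi> (E i k)\<close> has the column of \<open>\<phi> (E i j)\<close> and the row of \<open>\<phi> (E j k)\<close>, as for a homomorphism of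
  associative algebras, or the other way round, as for a negative antihomomorphism. A comparison
  of overlapping triples shows that the same alternative holds for all of them
  (\<open>image_unit_type\<close>), and composition with \<open>a \<mapsto> - a\<^sup>t\<close> exchanges the two.

  In the first alternative \<open>\<phi> (E i j) = u i \<otimes> g j\<close> for suitable vectors \<open>u i\<close> and functionals \<open>g j\<close>
  (\<open>image_units_in_coordinates\<close>). Trace zero and the bracket relations make them dual to each
  other, so with the \<open>u i\<close> as the columns of \<open>U\<close> and the \<open>g j\<close> as the rows of \<open>G\<close> one has
  \<open>G U = 1\<close> and \<open>\<phi> a = U a G\<close>. Surjectivity of \<open>\<phi>\<close> then yields both \<open>U G = 1\<close> and the remaining
  finiteness conditions, and \<open>x = G\<close> (\<open>dual_bases_conjugation\<close>).
\<close>

section \<open>Products with rank-one matrices\<close>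

definition outer :: "('i \<Rightarrow> 'f::field) \<Rightarrow> ('i \<Rightarrow> 'f) \<Rightarrow> ('i, 'f) mat" where
  "outer u g = (\<lambda>i j. u i * g j)"

text \<open>
  The value of the functional \<open>g\<close>, a row, at the vector \<open>u\<close>, a column.
\<close>

definition dot :: "('i \<Rightarrow> 'f::field) \<Rightarrow> ('i \<Rightarrow> 'f) \<Rightarrow> 'f" where
  "dot g u = Sum_any (\<lambda>k. g k * u k)"

definition unit_vec :: "'i \<Rightarrow> 'i \<Rightarrow> 'f::field" where
  "unit_vec i = (\<lambda>k. if k = i then 1 else 0)"

definition mat_unit :: "'i \<Rightarrow> 'i \<Rightarrow> ('i, 'f::field) mat" where
  "mat_unit i j = outer (unit_vec i) (unit_vec j)"

text \<open>
  In a field a nonzero factor leaves the support unchanged, so for an infinite support both sides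
  are zero by convention. The product rules for \<^const>\<open>outer\<close> below therefore hold for arbitrary
  vectors and matrices.
\<close>

lemma Sum_any_mult_right: "Sum_any (\<lambda>k. f k * c) = Sum_any f * c" for c :: "'f::field"
proof (cases "finite {k. f k \<noteq> 0}")
  case True
  then show ?thesis by (rule Sum_any_left_distrib[symmetric])
next
  case False
  then show ?thesis by (cases "c = 0") (auto simp: Sum_any.infinite)
qed

lemma Sum_any_mult_left: "Sum_any (\<lambda>k. c * f k) = c * Sum_any f" for c :: "'f::field"
  using Sum_any_mult_right[of f c] by (simp add: mult.commute)

lemma outer_eq_0_iff: "outer u g = 0 \<longleftrightarrow> u = 0 \<or> g = 0"
  by (auto simp: outer_def fun_eq_iff)

lemma mat_scale_outer:
  "mat_scale c (outer u g) = outer (\<lambda>k. c * u k) g"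
  "mat_scale c (outer u g) = outer u (\<lambda>k. c * g k)"
  by (auto simp: mat_scale_def outer_def fun_eq_iff)

lemma mat_scale_eq_0_iff: "mat_scale c a = 0 \<longleftrightarrow> c = 0 \<or> a = 0"
  by (auto simp: mat_scale_def fun_eq_iff)

lemma dot_unit_vec: "dot f (unit_vec i) = f i" "dot (unit_vec i) f = f i"
proof -
  have "dot f (unit_vec i) = (\<Sum>k\<in>{i}. f k * unit_vec i k)"
    unfolding dot_def by (rule Sum_any.expand_superset) (auto simp: unit_vec_def)
  then show "dot f (unit_vec i) = f i" by (simp add: unit_vec_def)
  have "dot (unit_vec i) f = (\<Sum>k\<in>{i}. unit_vec i k * f k)"
    unfolding dot_def by (rule Sum_any.expand_superset) (auto simp: unit_vec_def)
  then show "dot (unit_vec i) f = f i" by (simp add: unit_vec_def)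
qed

lemma dot_mult_left: "dot (\<lambda>k. c * f k) u = c * dot f u"
  by (simp add: dot_def mult.assoc Sum_any_mult_left)

lemma dot_mult_right: "dot f (\<lambda>k. c * u k) = c * dot f u"
  by (simp only: dot_def mult.left_commute[of "f _" c] Sum_any_mult_left)

lemma mat_mult_outer: "a \<star> outer v h = outer (\<lambda>i. dot (a i) v) h"
  by (auto simp: mat_mult_def outer_def dot_def fun_eq_iff mult.assoc[symmetric] Sum_any_mult_right)

lemma outer_mat_mult: "outer u g \<star> a = outer u (\<lambda>j. dot g (\<lambda>k. a k j))"
  by (auto simp: mat_mult_def outer_def dot_def fun_eq_iff mult.assoc Sum_any_mult_left)

lemma outer_mult_outer: "outer u g \<star> outer v h = mat_scale (dot g v) (outer u h)"
  unfolding outer_mat_mult mat_scale_outer(2)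
  by (simp add: dot_def outer_def mult.assoc[symmetric] Sum_any_mult_right)

lemma lie_bracket_outer:
  "lie_bracket (outer u g) (outer v h)
     = mat_scale (dot g v) (outer u h) - mat_scale (dot h u) (outer v g)"
  by (simp add: lie_bracket_def outer_mult_outer)

lemma mat_unit_apply: "mat_unit i j k l = (if k = i \<and> l = j then 1 else 0)"
  by (simp add: mat_unit_def outer_def unit_vec_def)

lemma mat_unit_nonzero: "mat_unit i j \<noteq> 0"
  by (auto simp: mat_unit_apply fun_eq_iff)

lemma mat_mult_unit: "a \<star> mat_unit i j = outer (\<lambda>k. a k i) (unit_vec j)"
  by (simp add: mat_unit_def mat_mult_outer dot_unit_vec)

lemma mat_unit_mult: "mat_unit i j \<star> a = outer (unit_vec i) (a j)"
  by (simp add: mat_unit_def outer_mat_mult dot_unit_vec)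

lemma mat_unit_mult_unit:
  "mat_unit i j \<star> mat_unit k l = (if j = k then mat_unit i l else 0)"
  unfolding mat_unit_def outer_mult_outer dot_unit_vec
  by (auto simp: mat_scale_def unit_vec_def fun_eq_iff)

section \<open>Finitely supported vectors and finitary matrices\<close>

definition vec_fin :: "'i set \<Rightarrow> ('i \<Rightarrow> 'f::field) set" where
  "vec_fin I = {u. {i. u i \<noteq> 0} \<subseteq> I \<and> finite {i. u i \<noteq> 0}}"

lemma dot_diff_left:
  assumes "v \<in> vec_fin I"
  shows "dot (\<lambda>j. f j - g j) v = dot f v - dot g v"
proof -
  have fin: "finite {k. v k \<noteq> 0}" using assms by (simp add: vec_fin_def)
  have "dot f v = (\<Sum>k | v k \<noteq> 0. f k * v k)" for f
    unfolding dot_def by (rule Sum_any.expand_superset[OF fin]) auto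
  then show ?thesis by (simp add: left_diff_distrib sum_subtractf)
qed

lemma outer_in_M_fin:
  assumes "u \<in> vec_fin I" "g \<in> vec_fin I"
  shows "outer u g \<in> M_fin I"
  by (rule M_fin_I[where S = "{i. u i \<noteq> 0} \<times> {i. g i \<noteq> 0}"])
    (use assms in \<open>auto simp: outer_def vec_fin_def\<close>)

lemma outer_in_M_finD:
  assumes "outer u g \<in> M_fin I" "outer u g \<noteq> 0"
  shows "u \<in> vec_fin I" "g \<in> vec_fin I"
proof -
  let ?S = "{(i, j). outer u g i j \<noteq> 0}"
  obtain i j where ij: "u i \<noteq> 0" "g j \<noteq> 0"
    using assms(2) by (auto simp: outer_def fun_eq_iff)
  have fin: "finite ?S" and sub: "?S \<subseteq> I \<times> I" using assms(1) by (auto simp: M_fin_def)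
  have u: "{k. u k \<noteq> 0} \<subseteq> fst ` ?S" using ij by (force simp: outer_def image_iff)
  have g: "{k. g k \<noteq> 0} \<subseteq> snd ` ?S" using ij by (force simp: outer_def image_iff)
  have "fst ` ?S \<subseteq> I" "snd ` ?S \<subseteq> I" using sub by auto
  then show "u \<in> vec_fin I" "g \<in> vec_fin I"
    using u g finite_subset[OF u] finite_subset[OF g] fin by (auto simp: vec_fin_def)
qed

lemma unit_vec_in_vec_fin: "i \<in> I \<Longrightarrow> unit_vec i \<in> vec_fin I"
  by (auto simp: vec_fin_def unit_vec_def)

lemma M_fin_row_col:
  assumes "a \<in> M_fin I"
  shows "(\<lambda>k. a k j) \<in> vec_fin I" "a i \<in> vec_fin I"
proof -
  have "a \<in> M_rcf I" using assms M_fin_subset_M_rcf by auto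
  note D = M_rcf_D[OF this]
  show "(\<lambda>k. a k j) \<in> vec_fin I" "a i \<in> vec_fin I"
    using D(1,2,3) by (auto simp: vec_fin_def)
qed

lemma M_fin_support:
  assumes "a \<in> M_fin I"
  obtains J where "finite J" "J \<subseteq> I" "\<And>i j. a i j \<noteq> 0 \<Longrightarrow> i \<in> J \<and> j \<in> J"
proof
  let ?A = "{(i, j). a i j \<noteq> 0}" and ?J = "fst ` {(i, j). a i j \<noteq> 0} \<union> snd ` {(i, j). a i j \<noteq> 0}"
  show "finite ?J" "?J \<subseteq> I" using assms by (auto simp: M_fin_def)
  show "i \<in> ?J \<and> j \<in> ?J" if "a i j \<noteq> 0" for i j
  proof -
    have "(i, j) \<in> ?A" using that by simp
    from imageI[OF this, of fst] imageI[OF this, of snd] show ?thesis by simp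
  qed
qed

lemma mat_mult_scale:
  "mat_scale c a \<star> b = mat_scale c (a \<star> b)" "a \<star> mat_scale c b = mat_scale c (a \<star> b)"
proof -
  show "mat_scale c a \<star> b = mat_scale c (a \<star> b)"
    by (simp add: mat_mult_def mat_scale_def fun_eq_iff mult.assoc Sum_any_mult_left)
  have "a i k * (c * b k j) = c * (a i k * b k j)" for i j k
    by (rule mult.left_commute)
  then show "a \<star> mat_scale c b = mat_scale c (a \<star> b)"
    by (simp only: mat_mult_def mat_scale_def Sum_any_mult_left)
qed

lemma mat_mult_add_right:
  assumes "a \<in> M_fin I" "b \<in> M_fin I"
  shows "c \<star> (a + b) = c \<star> a + c \<star> b"
proof (intro ext)
  fix i j
  let ?S = "{k. a k j \<noteq> 0} \<union> {k. b k j \<noteq> 0}"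
  have S: "finite ?S" using assms[THEN M_fin_row_col(1)] by (auto simp: vec_fin_def)
  have "(c \<star> (a + b)) i j = (\<Sum>k\<in>?S. c i k * (a + b) k j)"
    by (rule mat_mult_eq_sum[OF S]) auto
  moreover have "(c \<star> a) i j = (\<Sum>k\<in>?S. c i k * a k j)"
    by (rule mat_mult_eq_sum[OF S]) auto
  moreover have "(c \<star> b) i j = (\<Sum>k\<in>?S. c i k * b k j)"
    by (rule mat_mult_eq_sum[OF S]) auto
  ultimately show "(c \<star> (a + b)) i j = (c \<star> a + c \<star> b) i j"
    by (simp add: sum.distrib distrib_left)
qed

lemma mat_mult_add_left:
  assumes "a \<in> M_fin I" "b \<in> M_fin I"
  shows "(a + b) \<star> c = a \<star> c + b \<star> c"
proof (intro ext)
  fix i j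
  let ?S = "{k. a i k \<noteq> 0} \<union> {k. b i k \<noteq> 0}"
  have S: "finite ?S" using assms[THEN M_fin_row_col(2)] by (auto simp: vec_fin_def)
  have "((a + b) \<star> c) i j = (\<Sum>k\<in>?S. (a + b) i k * c k j)"
    by (rule mat_mult_eq_sum[OF S]) auto
  moreover have "(a \<star> c) i j = (\<Sum>k\<in>?S. a i k * c k j)"
    by (rule mat_mult_eq_sum[OF S]) auto
  moreover have "(b \<star> c) i j = (\<Sum>k\<in>?S. b i k * c k j)"
    by (rule mat_mult_eq_sum[OF S]) auto
  ultimately show "((a + b) \<star> c) i j = (a \<star> c + b \<star> c) i j"
    by (simp add: sum.distrib distrib_right)
qed

lemma mat_diff_eq_add_scale: "a - b = a + mat_scale (-1) b"
  by (simp add: mat_scale_def fun_eq_iff)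

lemma mat_mult_diff_right:
  assumes "a \<in> M_fin I" "b \<in> M_fin I"
  shows "c \<star> (a - b) = c \<star> a - c \<star> b"
  unfolding mat_diff_eq_add_scale
    mat_mult_add_right[OF assms(1) mat.subspace_scale[OF subspace_M_fin assms(2)]]
    mat_mult_scale ..

lemma mat_mult_diff_left:
  assumes "a \<in> M_fin I" "b \<in> M_fin I"
  shows "(a - b) \<star> c = a \<star> c - b \<star> c"
  unfolding mat_diff_eq_add_scale
    mat_mult_add_left[OF assms(1) mat.subspace_scale[OF subspace_M_fin assms(2)]]
    mat_mult_scale ..

text \<open>
  Products of matrices that are not both row- and column-finite need not associate. What
  makes the two double sums agree is that only finitely many paths \<open>i, j, k, l\<close> contribute
  to each entry.
\<close>

lemma mat_mult_assoc_finite_paths: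
  assumes fin: "\<And>i l. finite {(j, k). a i j \<noteq> 0 \<and> b j k \<noteq> 0 \<and> c k l \<noteq> 0}"
  shows "(a \<star> b) \<star> c = a \<star> (b \<star> c)"
proof (intro ext)
  fix i l
  let ?P = "{(j, k). a i j \<noteq> 0 \<and> b j k \<noteq> 0 \<and> c k l \<noteq> 0}"
  let ?S = "fst ` ?P" and ?T = "snd ` ?P"
  have S: "finite ?S" and T: "finite ?T" using fin by auto
  have memS: "j \<in> ?S" and memT: "k \<in> ?T" if "a i j \<noteq> 0" "b j k \<noteq> 0" "c k l \<noteq> 0" for j k
    using that by (auto simp: image_iff)
  have ab: "(a \<star> b) i k * c k l = (\<Sum>j\<in>?S. a i j * b j k) * c k l" for k
  proof (cases "c k l = 0")
    case False
    then have "(a \<star> b) i k = (\<Sum>j\<in>?S. a i j * b j k)"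
      by (intro mat_mult_eq_sum[OF S] memS[of _ k]) auto
    then show ?thesis by simp
  qed simp
  have bc: "a i j * (b \<star> c) j l = a i j * (\<Sum>k\<in>?T. b j k * c k l)" for j
  proof (cases "a i j = 0")
    case False
    then have "(b \<star> c) j l = (\<Sum>k\<in>?T. b j k * c k l)"
      by (intro mat_mult_eq_sum[OF T] memT[of j]) auto
    then show ?thesis by simp
  qed simp
  have "((a \<star> b) \<star> c) i l = (\<Sum>k\<in>?T. (a \<star> b) i k * c k l)"
  proof (rule mat_mult_eq_sum[OF T])
    fix k assume "(a \<star> b) i k * c k l \<noteq> 0"
    then obtain j where "a i j \<noteq> 0" "b j k \<noteq> 0" "c k l \<noteq> 0" by (auto elim: mat_mult_nonzeroE)
    then show "k \<in> ?T" by (rule memT)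
  qed
  also have "\<dots> = (\<Sum>j\<in>?S. \<Sum>k\<in>?T. a i j * b j k * c k l)"
    unfolding ab sum_distrib_right by (rule sum.swap)
  also have "\<dots> = (\<Sum>j\<in>?S. a i j * (b \<star> c) j l)"
    unfolding bc sum_distrib_left by (simp add: mult.assoc)
  also have "\<dots> = (a \<star> (b \<star> c)) i l"
  proof (rule mat_mult_eq_sum[OF S, symmetric])
    fix j assume "a i j * (b \<star> c) j l \<noteq> 0"
    then obtain k where "a i j \<noteq> 0" "b j k \<noteq> 0" "c k l \<noteq> 0" by (auto elim: mat_mult_nonzeroE)
    then show "j \<in> ?S" by (rule memS)
  qed
  finally show "((a \<star> b) \<star> c) i l = (a \<star> (b \<star> c)) i l" .
qed

lemma mat_mult_assoc_row_col:
  assumes "\<And>i. finite {j. a i j \<noteq> 0}" "\<And>l. finite {k. c k l \<noteq> 0}"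
  shows "(a \<star> b) \<star> c = a \<star> (b \<star> c)"
proof (rule mat_mult_assoc_finite_paths)
  fix i l
  show "finite {(j, k). a i j \<noteq> 0 \<and> b j k \<noteq> 0 \<and> c k l \<noteq> 0}"
    by (rule finite_subset[OF _ finite_cartesian_product[OF assms(1)[of i] assms(2)[of l]]]) auto
qed

lemma mat_mult_assoc_middle:
  assumes "b \<in> M_fin I"
  shows "(a \<star> b) \<star> c = a \<star> (b \<star> c)"
proof (rule mat_mult_assoc_finite_paths)
  fix i l
  have fin: "finite {(j, k). b j k \<noteq> 0}" using assms by (simp add: M_fin_def)
  show "finite {(j, k). a i j \<noteq> 0 \<and> b j k \<noteq> 0 \<and> c k l \<noteq> 0}"
    by (rule finite_subset[OF _ fin]) auto
qed

lemma mat_mult_in_M_fin_left: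
  assumes "\<And>j. (\<lambda>i. c i j) \<in> vec_fin I" "a \<in> M_fin I"
  shows "c \<star> a \<in> M_fin I"
proof -
  obtain J where J: "finite J" "J \<subseteq> I" "\<And>i j. a i j \<noteq> 0 \<Longrightarrow> i \<in> J \<and> j \<in> J"
    using M_fin_support[OF assms(2)] by metis
  have sub: "{i. c i k \<noteq> 0} \<subseteq> I" and fin: "finite {i. c i k \<noteq> 0}" for k
    using assms(1)[of k] by (simp_all add: vec_fin_def)
  show ?thesis
  proof (rule M_fin_I[where S = "(\<Union>k\<in>J. {i. c i k \<noteq> 0}) \<times> J"])
    show "(i, j) \<in> (\<Union>k\<in>J. {i. c i k \<noteq> 0}) \<times> J" if "(c \<star> a) i j \<noteq> 0" for i j
      using that J(3) by (elim mat_mult_nonzeroE) auto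
  qed (use J(1,2) sub fin in auto)
qed

lemma mat_mult_in_M_fin_right:
  assumes "\<And>i. c i \<in> vec_fin I" "a \<in> M_fin I"
  shows "a \<star> c \<in> M_fin I"
proof -
  obtain J where J: "finite J" "J \<subseteq> I" "\<And>i j. a i j \<noteq> 0 \<Longrightarrow> i \<in> J \<and> j \<in> J"
    using M_fin_support[OF assms(2)] by metis
  have sub: "{j. c k j \<noteq> 0} \<subseteq> I" and fin: "finite {j. c k j \<noteq> 0}" for k
    using assms(1)[of k] by (simp_all add: vec_fin_def)
  show ?thesis
  proof (rule M_fin_I[where S = "J \<times> (\<Union>k\<in>J. {j. c k j \<noteq> 0})"])
    show "(i, j) \<in> J \<times> (\<Union>k\<in>J. {j. c k j \<noteq> 0})" if "(a \<star> c) i j \<noteq> 0" for i j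
      using that J(3) by (elim mat_mult_nonzeroE) auto
  qed (use J(1,2) sub fin in auto)
qed

section \<open>The Lie algebra of finitary matrices of trace zero\<close>

definition mat_trace :: "('i, 'f::field) mat \<Rightarrow> 'f" where
  "mat_trace a = Sum_any (\<lambda>i. a i i)"

lemma mat_trace_outer: "mat_trace (outer u g) = dot g u"
  by (simp add: mat_trace_def outer_def dot_def mult.commute)

lemma mat_trace_eq_sum:
  assumes "finite J" "\<And>i. a i i \<noteq> 0 \<Longrightarrow> i \<in> J"
  shows "mat_trace a = (\<Sum>i\<in>J. a i i)"
  unfolding mat_trace_def by (rule Sum_any.expand_superset) (use assms in auto)

lemma mat_trace_add:
  assumes "a \<in> M_fin I" "b \<in> M_fin I"
  shows "mat_trace (a + b) = mat_trace a + mat_trace b"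
proof -
  obtain J where J: "finite J" "\<And>i j. a i j \<noteq> 0 \<Longrightarrow> i \<in> J \<and> j \<in> J"
    using M_fin_support[OF assms(1)] by metis
  obtain K where K: "finite K" "\<And>i j. b i j \<noteq> 0 \<Longrightarrow> i \<in> K \<and> j \<in> K"
    using M_fin_support[OF assms(2)] by metis
  have fin: "finite (J \<union> K)" using J K by simp
  have sums: "mat_trace c = (\<Sum>i\<in>J \<union> K. c i i)"
    if "\<And>i. c i i \<noteq> 0 \<Longrightarrow> a i i \<noteq> 0 \<or> b i i \<noteq> 0" for c
    by (rule mat_trace_eq_sum[OF fin]) (use that J(2) K(2) in blast)
  have "mat_trace a = (\<Sum>i\<in>J \<union> K. a i i)" "mat_trace b = (\<Sum>i\<in>J \<union> K. b i i)"
    by (rule sums; blast)+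
  moreover have "mat_trace (a + b) = (\<Sum>i\<in>J \<union> K. (a + b) i i)"
    by (rule sums) auto
  ultimately show ?thesis by (simp add: sum.distrib)
qed

lemma mat_trace_scale: "mat_trace (mat_scale c a) = c * mat_trace a"
  by (simp add: mat_trace_def mat_scale_def Sum_any_mult_left)

lemma mat_trace_mult_commute:
  assumes "a \<in> M_fin I" "b \<in> M_fin I"
  shows "mat_trace (a \<star> b) = mat_trace (b \<star> a)"
proof -
  obtain J where J: "finite J" "\<And>i j. a i j \<noteq> 0 \<Longrightarrow> i \<in> J \<and> j \<in> J"
    using M_fin_support[OF assms(1)] by metis
  obtain K where K: "finite K" "\<And>i j. b i j \<noteq> 0 \<Longrightarrow> i \<in> K \<and> j \<in> K"
    using M_fin_support[OF assms(2)] by metis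
  let ?L = "J \<union> K"
  have fin: "finite ?L" using J K by simp
  have ab: "mat_trace (a \<star> b) = (\<Sum>i\<in>?L. \<Sum>k\<in>?L. a i k * b k i)"
  proof -
    have "mat_trace (a \<star> b) = (\<Sum>i\<in>?L. (a \<star> b) i i)"
      by (rule mat_trace_eq_sum[OF fin]) (use J(2) in \<open>auto elim!: mat_mult_nonzeroE\<close>)
    moreover have "(a \<star> b) i i = (\<Sum>k\<in>?L. a i k * b k i)" for i
      by (rule mat_mult_eq_sum[OF fin]) (use J(2) in auto)
    ultimately show ?thesis by simp
  qed
  have ba: "mat_trace (b \<star> a) = (\<Sum>k\<in>?L. \<Sum>i\<in>?L. b k i * a i k)"
  proof -
    have "mat_trace (b \<star> a) = (\<Sum>k\<in>?L. (b \<star> a) k k)"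
      by (rule mat_trace_eq_sum[OF fin]) (use K(2) in \<open>auto elim!: mat_mult_nonzeroE\<close>)
    moreover have "(b \<star> a) k k = (\<Sum>i\<in>?L. b k i * a i k)" for k
      by (rule mat_mult_eq_sum[OF fin]) (use J(2) in auto)
    ultimately show ?thesis by simp
  qed
  show ?thesis unfolding ab ba by (subst sum.swap) (simp add: mult.commute)
qed

lemma subspace_sl_inf: "mat.subspace (sl_inf I)"
  unfolding sl_inf_def by (rule mat.subspace_span)

lemma sl_inf_M_fin: "a \<in> sl_inf I \<Longrightarrow> a \<in> M_fin I"
  using sl_inf_subset_M_fin by auto

lemma sl_inf_M_rcf: "a \<in> sl_inf I \<Longrightarrow> a \<in> M_rcf I"
  using sl_inf_M_fin M_fin_subset_M_rcf by blast

lemma lie_bracket_in_sl_inf: "a \<in> M_fin I \<Longrightarrow> b \<in> M_fin I \<Longrightarrow> lie_bracket a b \<in> sl_inf I"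
  unfolding sl_inf_def by (intro mat.span_base) auto

text \<open>
  An automorphism is linear only on the Lie algebra, and multiplication by an arbitrary matrix
  need not be additive beyond the finitary matrices, so linearity is required on a subspace that contains the
  generators.
\<close>

lemma linear_image_of_span:
  assumes "mat.subspace S" "mat.subspace T" "B \<subseteq> S" "\<And>b. b \<in> B \<Longrightarrow> f b \<in> T" "a \<in> mat.span B"
    and add: "\<And>a b. a \<in> S \<Longrightarrow> b \<in> S \<Longrightarrow> f (a + b) = f a + f b"
    and scale: "\<And>c a. a \<in> S \<Longrightarrow> f (mat_scale c a) = mat_scale c (f a)"
  shows "f a \<in> T"
proof -
  have "mat.subspace {a \<in> S. f a \<in> T}"
  proof (rule mat.subspaceI)
    have "f 0 = 0" using scale[of 0 0] assms(1) by (simp add: mat.subspace_0)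
    then show "0 \<in> {a \<in> S. f a \<in> T}" using assms(1,2) by (simp add: mat.subspace_0)
  qed (use assms(1,2) add scale in \<open>auto intro: mat.subspace_add mat.subspace_scale\<close>)
  moreover have "B \<subseteq> {a \<in> S. f a \<in> T}" using assms(3,4) by auto
  ultimately have "mat.span B \<subseteq> {a \<in> S. f a \<in> T}" by (rule mat.span_minimal[rotated])
  then show ?thesis using assms(5) by auto
qed

lemma mat_trace_sl_inf:
  fixes a :: "('i, 'f::field) mat"
  assumes "a \<in> sl_inf I"
  shows "mat_trace a = 0"
proof -
  have "mat_trace (lie_bracket b c) = 0" if bc: "b \<in> M_fin I" "c \<in> M_fin I"
    for b c :: "('i, 'f) mat"
    using mat_trace_add[OF M_fin_mult_closed[OF bc]
        mat.subspace_scale[OF subspace_M_fin M_fin_mult_closed[OF bc(2,1)]], of "-1"]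
      mat_trace_mult_commute[OF bc]
    by (simp only: lie_bracket_def mat_diff_eq_add_scale mat_trace_scale) simp
  then have "(sl_inf I :: ('i, 'f) mat set) \<subseteq> {a \<in> M_fin I. mat_trace a = 0}"
    unfolding sl_inf_def
  proof (intro mat.span_minimal)
    show "mat.subspace {a \<in> M_fin I. mat_trace a = (0::'f)}"
    proof (rule mat.subspaceI)
      have "mat_trace (0 :: ('i, 'f) mat) = 0" by (simp add: mat_trace_def)
      then show "(0 :: ('i, 'f) mat) \<in> {a \<in> M_fin I. mat_trace a = 0}"
        using mat.subspace_0[OF subspace_M_fin] by simp
    qed (auto simp: mat_trace_add mat_trace_scale intro: mat.subspace_add[OF subspace_M_fin]
        mat.subspace_scale[OF subspace_M_fin])
  qed (use lie_bracket_in_sl_inf sl_inf_subset_M_fin in blast)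
  then show ?thesis using assms by auto
qed

lemma dot_eq_0_of_outer_in_sl_inf: "outer u g \<in> sl_inf I \<Longrightarrow> dot g u = 0"
  using mat_trace_sl_inf[of "outer u g" I] by (simp add: mat_trace_outer)

text \<open>
  Any index \<open>k \<in> I\<close> exhibits \<open>u \<otimes> g\<close> as the bracket of \<open>u \<otimes> e k\<close> and \<open>e k \<otimes> g\<close>: the other product
  contributes the multiple \<open>g u = 0\<close> of \<open>e k \<otimes> e k\<close>.
\<close>

lemma outer_in_sl_inf:
  assumes "I \<noteq> {}" and u: "u \<in> vec_fin I" and g: "g \<in> vec_fin I" and ug: "dot g u = 0"
  shows "outer u g \<in> sl_inf I"
proof -
  obtain k where k: "k \<in> I" using assms(1) by auto
  have "outer u g = lie_bracket (outer u (unit_vec k)) (outer (unit_vec k) g)"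
    unfolding lie_bracket_outer ug dot_unit_vec by (simp add: unit_vec_def mat_scale_def fun_eq_iff)
  then show ?thesis
    using lie_bracket_in_sl_inf outer_in_M_fin u g unit_vec_in_vec_fin[OF k] by metis
qed

lemma mat_unit_in_M_fin: "i \<in> I \<Longrightarrow> j \<in> I \<Longrightarrow> mat_unit i j \<in> M_fin I"
  unfolding mat_unit_def by (intro outer_in_M_fin unit_vec_in_vec_fin)

lemma mat_unit_in_sl_inf:
  assumes "i \<in> I" "j \<in> I" "i \<noteq> j"
  shows "mat_unit i j \<in> sl_inf I"
proof -
  have "mat_unit i j = lie_bracket (mat_unit i i) (mat_unit i j)"
    using assms(3) by (simp add: lie_bracket_def mat_unit_mult_unit)
  then show ?thesis using lie_bracket_in_sl_inf mat_unit_in_M_fin assms by metis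
qed

lemma M_fin_in_span_units:
  assumes J: "finite J" "\<And>i j. a i j \<noteq> 0 \<Longrightarrow> i \<in> J \<and> j \<in> J"
  shows "a \<in> mat.span {mat_unit i j | i j. i \<in> J \<and> j \<in> J}"
proof -
  have "a = (\<Sum>i\<in>J. \<Sum>j\<in>J. mat_scale (a i j) (mat_unit i j))"
  proof (intro ext)
    fix k l
    have ap: "sum f S k l = (\<Sum>x\<in>S. f x k l)" for f :: "'a \<Rightarrow> ('a, 'b) mat" and S
      by (induction S rule: infinite_finite_induct) auto
    have "(\<Sum>i\<in>J. \<Sum>j\<in>J. mat_scale (a i j) (mat_unit i j)) k l
      = (\<Sum>i\<in>J. \<Sum>j\<in>J. if k = i then if l = j then a i j else 0 else 0)"
      unfolding ap by (intro sum.cong refl) (auto simp: mat_scale_def mat_unit_apply)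
    also have "\<dots> = (\<Sum>i\<in>J. if k = i then (\<Sum>j\<in>J. if l = j then a i j else 0) else 0)"
      by (intro sum.cong refl) auto
    also have "\<dots> = a k l" using J by (auto simp: sum.delta')
    finally show "a k l = (\<Sum>i\<in>J. \<Sum>j\<in>J. mat_scale (a i j) (mat_unit i j)) k l" ..
  qed
  also have "\<dots> \<in> mat.span {mat_unit i j | i j. i \<in> J \<and> j \<in> J}"
    by (intro mat.span_sum mat.span_scale mat.span_base) auto
  finally show ?thesis .
qed

text \<open>
  For distinct \<open>i, j\<close> the bracket of \<open>E i j\<close> and \<open>E j i\<close> is the diagonal matrix \<open>E i i - E j j\<close>.
  Written as a bracket of off-diagonal units, its image under an automorphism is determined by
  those of the units.
\<close>

definition sl_gens :: "'i set \<Rightarrow> ('i, 'f::field) mat set" where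
  "sl_gens I = {mat_unit i j | i j. i \<in> I \<and> j \<in> I \<and> i \<noteq> j} \<union>
     {lie_bracket (mat_unit i j) (mat_unit j i) | i j. i \<in> I \<and> j \<in> I \<and> i \<noteq> j}"

lemma lie_bracket_linear:
  assumes "a \<in> M_fin I" "b \<in> M_fin I" "c \<in> M_fin I"
  shows "lie_bracket (a + b) c = lie_bracket a c + lie_bracket b c"
    and "lie_bracket c (a + b) = lie_bracket c a + lie_bracket c b"
  unfolding lie_bracket_def mat_mult_add_left[OF assms(1,2)] mat_mult_add_right[OF assms(1,2)]
  by simp_all

lemma mat_scale_diff: "mat_scale c (a - b) = mat_scale c a - mat_scale c b"
  by (rule mat.scale_right_diff_distrib)

lemma lie_bracket_scale:
  "lie_bracket (mat_scale r a) b = mat_scale r (lie_bracket a b)"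
  "lie_bracket a (mat_scale r b) = mat_scale r (lie_bracket a b)"
  by (simp_all add: lie_bracket_def mat_mult_scale mat_scale_diff)

lemma lie_bracket_units_in_span:
  assumes I: "i \<in> I" "j \<in> I" "k \<in> I" "l \<in> I"
  shows "lie_bracket (mat_unit i j) (mat_unit k l) \<in> mat.span (sl_gens I)"
proof (cases "j = k \<and> l = i")
  case True
  then show ?thesis
    using I by (cases "i = j") (auto simp: sl_gens_def lie_bracket_def mat.span_zero
        intro!: mat.span_base)
next
  case False
  have unit: "mat_unit p q \<in> mat.span (sl_gens I)" if "p \<in> I" "q \<in> I" "p \<noteq> q" for p q
    using that by (intro mat.span_base) (auto simp: sl_gens_def)
  have "(if j = k then mat_unit i l else 0) \<in> mat.span (sl_gens I)"
    "(if l = i then mat_unit k j else 0) \<in> mat.span (sl_gens I)"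
    using False I unit by (auto simp: mat.span_zero)
  then show ?thesis
    unfolding lie_bracket_def mat_unit_mult_unit by (rule mat.span_diff)
qed

lemma sl_inf_subset_span_gens: "sl_inf I \<subseteq> mat.span (sl_gens I)"
proof -
  let ?E = "{mat_unit i j | i j. i \<in> I \<and> j \<in> I} :: ('a, 'b) mat set"
  let ?S = "mat.span (sl_gens I) :: ('a, 'b) mat set"
  have fin: "?E \<subseteq> M_fin I" using mat_unit_in_M_fin by auto
  have E: "M_fin I \<subseteq> mat.span ?E"
  proof
    fix a :: "('a, 'b) mat" assume "a \<in> M_fin I"
    then obtain J where J: "finite J" "J \<subseteq> I" "\<And>i j. a i j \<noteq> 0 \<Longrightarrow> i \<in> J \<and> j \<in> J"
      using M_fin_support by metis
    have "a \<in> mat.span {mat_unit i j | i j. i \<in> J \<and> j \<in> J}"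
      by (rule M_fin_in_span_units[OF J(1,3)])
    also have "\<dots> \<subseteq> mat.span ?E" using J(2) by (intro mat.span_mono) blast
    finally show "a \<in> mat.span ?E" .
  qed
  have step1: "lie_bracket a b \<in> ?S" if "a \<in> ?E" "b \<in> M_fin I" for a b
  proof (rule linear_image_of_span[OF subspace_M_fin mat.subspace_span fin, where f = "lie_bracket a"])
    show "b \<in> mat.span ?E" using that(2) E by blast
    show "lie_bracket a e \<in> ?S" if "e \<in> ?E" for e
      using that \<open>a \<in> ?E\<close> by (auto intro: lie_bracket_units_in_span)
  qed (use that fin in \<open>auto intro: lie_bracket_linear(2) lie_bracket_scale(2)\<close>)
  have "lie_bracket a b \<in> ?S" if "a \<in> M_fin I" "b \<in> M_fin I" for a b
  proof (rule linear_image_of_span[OF subspace_M_fin mat.subspace_span fin,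
        where f = "\<lambda>a. lie_bracket a b"])
    show "a \<in> mat.span ?E" using that(1) E by blast
    show "lie_bracket e b \<in> ?S" if "e \<in> ?E" for e
      by (rule step1[OF that \<open>b \<in> M_fin I\<close>])
  qed (use that in \<open>auto intro: lie_bracket_linear(1) lie_bracket_scale(1)\<close>)
  then show ?thesis
    unfolding sl_inf_def[of I] by (intro mat.span_minimal mat.subspace_span) auto
qed

section \<open>Rank one in terms of commutation\<close>

definition bounded_support :: "('i, 'f::field) mat set \<Rightarrow> bool" where
  "bounded_support S \<longleftrightarrow> (\<exists>J. finite J \<and> (\<forall>a\<in>S. \<forall>i j. a i j \<noteq> 0 \<longrightarrow> i \<in> J \<and> j \<in> J))"

text \<open>
  The set is the image of the centralizer \<open>C(b)\<close> under \<open>ad a\<close>, hence isomorphic to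
  \<open>C(b) / (C(a) \<inter> C(b))\<close>; for finitary matrices bounded support means finite dimension.
\<close>

definition almost_below :: "'i set \<Rightarrow> ('i, 'f::field) mat \<Rightarrow> ('i, 'f) mat \<Rightarrow> bool" where
  "almost_below I a b \<longleftrightarrow>
     bounded_support {lie_bracket a x | x. x \<in> sl_inf I \<and> lie_bracket b x = 0}"

definition lie_minimal :: "'i set \<Rightarrow> ('i, 'f::field) mat \<Rightarrow> bool" where
  "lie_minimal I b \<longleftrightarrow> b \<in> sl_inf I \<and> b \<noteq> 0 \<and>
     (\<forall>a \<in> sl_inf I. almost_below I a b \<longrightarrow> (\<exists>c. a = mat_scale c b))"

lemma bounded_support_mono: "bounded_support T \<Longrightarrow> S \<subseteq> T \<Longrightarrow> bounded_support S"
  unfolding bounded_support_def by (meson subsetD)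

lemma bounded_support_span:
  fixes B :: "('i, 'f::field) mat set"
  assumes "finite B" "B \<subseteq> M_fin I"
  shows "bounded_support (mat.span B)"
proof -
  define J where "J = (\<Union>b\<in>B. fst ` {(i, j). b i j \<noteq> 0} \<union> snd ` {(i, j). b i j \<noteq> 0})"
  have fin: "finite J" using assms by (auto simp: J_def M_fin_def)
  have "mat.span B \<subseteq> {a. \<forall>i j. \<not> (i \<in> J \<and> j \<in> J) \<longrightarrow> a i j = 0}"
  proof (rule mat.span_minimal)
    have "i \<in> J \<and> j \<in> J" if "b \<in> B" "b i j \<noteq> 0" for b i j
    proof -
      have "(i, j) \<in> {(i, j). b i j \<noteq> 0}" using that by simp
      from imageI[OF this, of fst] imageI[OF this, of snd] show ?thesis
        using that(1) unfolding J_def by auto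
    qed
    then show "B \<subseteq> {a. \<forall>i j. \<not> (i \<in> J \<and> j \<in> J) \<longrightarrow> a i j = 0}" by blast
    show "mat.subspace {a :: ('i, 'f) mat. \<forall>i j. \<not> (i \<in> J \<and> j \<in> J) \<longrightarrow> a i j = 0}"
      by (rule mat.subspaceI) (auto simp: mat_scale_def)
  qed
  then show ?thesis unfolding bounded_support_def using fin by blast
qed

text \<open>
  A set of finitary matrices has bounded support exactly when it spans a space of finite
  dimension, which is why a linear map cannot destroy this property.
\<close>

lemma bounded_support_linear_image:
  fixes S :: "('i, 'f::field) mat set" and f :: "('i, 'f) mat \<Rightarrow> ('i, 'f) mat"
  assumes S: "bounded_support S" "S \<subseteq> V" and V: "mat.subspace V" and f: "\<And>a. a \<in> V \<Longrightarrow> f a \<in> M_fin I"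
    and add: "\<And>a b. a \<in> V \<Longrightarrow> b \<in> V \<Longrightarrow> f (a + b) = f a + f b"
    and scale: "\<And>c a. a \<in> V \<Longrightarrow> f (mat_scale c a) = mat_scale c (f a)"
  shows "bounded_support (f ` S)"
proof -
  obtain J where J: "finite J" "\<And>a i j. a \<in> S \<Longrightarrow> a i j \<noteq> 0 \<Longrightarrow> i \<in> J \<and> j \<in> J"
    using S(1) by (auto simp: bounded_support_def)
  let ?E = "(\<lambda>(i, j). mat_unit i j) ` (J \<times> J) :: ('i, 'f) mat set"
  have E: "?E = {mat_unit i j | i j. i \<in> J \<and> j \<in> J}" by auto
  obtain B where B: "B \<subseteq> S" "mat.independent B" "S \<subseteq> mat.span B"
    using mat.maximal_independent_subset[of S] by blast
  have "finite B"
  proof (rule mat.independent_span_bound[THEN conjunct1, OF _ B(2)])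
    show "finite ?E" using J(1) by simp
    show "B \<subseteq> mat.span ?E"
      unfolding E using M_fin_in_span_units[OF J(1)] J(2) B(1) by blast
  qed
  then have "bounded_support (mat.span (f ` B))"
    using B(1) S(2) f by (intro bounded_support_span) auto
  moreover have "f ` S \<subseteq> mat.span (f ` B)"
  proof (rule image_subsetI)
    fix a assume "a \<in> S"
    show "f a \<in> mat.span (f ` B)"
    proof (rule linear_image_of_span[OF V mat.subspace_span, where B = B and f = f])
      show "a \<in> mat.span B" using \<open>a \<in> S\<close> B(3) by blast
    qed (use B(1) S(2) add scale in \<open>auto intro: mat.span_base\<close>)
  qed
  ultimately show ?thesis by (rule bounded_support_mono)
qed

context
  fixes I :: "'i set" and \<phi> :: "('i, 'f::field) mat \<Rightarrow> ('i, 'f) mat"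
  assumes aut: "lie_automorphism (sl_inf I) \<phi>"
begin

lemma automorphism_bij: "bij_betw \<phi> (sl_inf I) (sl_inf I)"
  using aut by (simp add: lie_automorphism_def)

lemma automorphism_in: "a \<in> sl_inf I \<Longrightarrow> \<phi> a \<in> sl_inf I"
  using automorphism_bij by (auto simp: bij_betw_def)

lemma automorphism_add: "a \<in> sl_inf I \<Longrightarrow> b \<in> sl_inf I \<Longrightarrow> \<phi> (a + b) = \<phi> a + \<phi> b"
  using aut by (simp add: lie_automorphism_def)

lemma automorphism_scale: "a \<in> sl_inf I \<Longrightarrow> \<phi> (mat_scale c a) = mat_scale c (\<phi> a)"
  using aut by (simp add: lie_automorphism_def)

lemma automorphism_bracket:
  "a \<in> sl_inf I \<Longrightarrow> b \<in> sl_inf I \<Longrightarrow> \<phi> (lie_bracket a b) = lie_bracket (\<phi> a) (\<phi> b)"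
  using aut by (simp add: lie_automorphism_def)

lemma automorphism_zero: "\<phi> 0 = 0"
  using automorphism_scale[OF mat.subspace_0[OF subspace_sl_inf], of 0] by simp

lemma automorphism_eq_iff: "a \<in> sl_inf I \<Longrightarrow> b \<in> sl_inf I \<Longrightarrow> \<phi> a = \<phi> b \<longleftrightarrow> a = b"
  using automorphism_bij by (auto simp: bij_betw_def inj_on_def)

lemma automorphism_eq_0_iff: "a \<in> sl_inf I \<Longrightarrow> \<phi> a = 0 \<longleftrightarrow> a = 0"
  using automorphism_eq_iff[OF _ mat.subspace_0[OF subspace_sl_inf]] by (simp add: automorphism_zero)

lemma automorphism_surj:
  assumes "b \<in> sl_inf I"
  obtains a where "a \<in> sl_inf I" "\<phi> a = b"
proof -
  have "b \<in> \<phi> ` sl_inf I" using assms automorphism_bij by (simp add: bij_betw_def)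
  then show ?thesis using that by blast
qed

text \<open>
  An automorphism carries centralizers to centralizers and brackets to brackets; boundedness is
  transported back along the inverse map, which is linear on the Lie algebra.
\<close>

lemma almost_below_automorphism:
  assumes a: "a \<in> sl_inf I" and b: "b \<in> sl_inf I" and below: "almost_below I (\<phi> a) (\<phi> b)"
  shows "almost_below I a b"
proof -
  let ?L = "sl_inf I :: ('i, 'f) mat set"
  let ?C = "\<lambda>a b. {lie_bracket a x | x. x \<in> ?L \<and> lie_bracket b x = 0}"
  define \<psi> where "\<psi> = inv_into ?L \<phi>"
  have \<psi>\<phi>: "\<psi> (\<phi> x) = x" if "x \<in> ?L" for x
    using automorphism_bij that by (simp add: \<psi>_def bij_betw_def)
  have "bounded_support (\<psi> ` ?C (\<phi> a) (\<phi> b))"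
  proof (rule bounded_support_linear_image[OF _ _ subspace_sl_inf])
    show "bounded_support (?C (\<phi> a) (\<phi> b))" using below by (simp add: almost_below_def)
    show "?C (\<phi> a) (\<phi> b) \<subseteq> ?L" using automorphism_in[OF a] sl_inf_bracket_closed by blast
    show "\<psi> x \<in> M_fin I" if x: "x \<in> ?L" for x
    proof -
      obtain x' where "x' \<in> ?L" "\<phi> x' = x" using automorphism_surj[OF x] .
      then show ?thesis using \<psi>\<phi> sl_inf_M_fin by metis
    qed
    show "\<psi> (x + y) = \<psi> x + \<psi> y" if x: "x \<in> ?L" and y: "y \<in> ?L" for x y
    proof -
      obtain x' where x': "x' \<in> ?L" "\<phi> x' = x" using automorphism_surj[OF x] .
      obtain y' where y': "y' \<in> ?L" "\<phi> y' = y" using automorphism_surj[OF y] .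
      have "x + y = \<phi> (x' + y')" using x' y' by (simp add: automorphism_add)
      then show ?thesis
        using x' y' \<psi>\<phi> mat.subspace_add[OF subspace_sl_inf x'(1) y'(1)] by metis
    qed
    show "\<psi> (mat_scale c x) = mat_scale c (\<psi> x)" if x: "x \<in> ?L" for c x
    proof -
      obtain x' where x': "x' \<in> ?L" "\<phi> x' = x" using automorphism_surj[OF x] .
      have "mat_scale c x = \<phi> (mat_scale c x')" using x' by (simp add: automorphism_scale)
      then show ?thesis
        using x' \<psi>\<phi> mat.subspace_scale[OF subspace_sl_inf x'(1)] by metis
    qed
  qed
  moreover have "?C a b \<subseteq> \<psi> ` ?C (\<phi> a) (\<phi> b)"
  proof
    fix y assume "y \<in> ?C a b"
    then obtain x where x: "x \<in> ?L" "lie_bracket b x = 0" "y = lie_bracket a x" by blast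
    have "lie_bracket (\<phi> b) (\<phi> x) = 0"
      using automorphism_bracket[OF b x(1)] x(2) automorphism_zero by simp
    then have \<phi>y: "\<phi> y \<in> ?C (\<phi> a) (\<phi> b)"
      using automorphism_bracket[OF a x(1)] x(1,3) automorphism_in by blast
    have "y = \<psi> (\<phi> y)" using \<psi>\<phi> sl_inf_bracket_closed[OF a x(1)] x(3) by simp
    then show "y \<in> \<psi> ` ?C (\<phi> a) (\<phi> b)" using \<phi>y by (rule image_eqI)
  qed
  ultimately show ?thesis unfolding almost_below_def by (rule bounded_support_mono)
qed

lemma lie_minimal_automorphism:
  assumes "lie_minimal I b"
  shows "lie_minimal I (\<phi> b)"
  unfolding lie_minimal_def
proof (intro conjI ballI impI)
  have b: "b \<in> sl_inf I" "b \<noteq> 0" using assms by (auto simp: lie_minimal_def)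
  show "\<phi> b \<in> sl_inf I" "\<phi> b \<noteq> 0"
    using b automorphism_in automorphism_eq_0_iff by auto
  fix a assume a: "a \<in> sl_inf I" "almost_below I a (\<phi> b)"
  obtain a' where a': "a' \<in> sl_inf I" "\<phi> a' = a" using automorphism_surj[OF a(1)] .
  have "almost_below I a' b" using almost_below_automorphism[OF a'(1) b(1)] a(2) a'(2) by simp
  then obtain c where "a' = mat_scale c b" using assms a'(1) by (auto simp: lie_minimal_def)
  then show "\<exists>c. a = mat_scale c (\<phi> b)" using a'(2) automorphism_scale[OF b(1)] by auto
qed

end

text \<open>
  For \<open>m \<noteq> j\<close> and all but finitely many \<open>k\<close>, the unit \<open>E m k\<close> commutes with \<open>E i j\<close>, and its bracket
  with \<open>a\<close> is column \<open>m\<close> of \<open>a\<close> moved to column \<open>k\<close>. If these brackets have bounded support, that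
  column vanishes. The units \<open>E k m\<close> with \<open>m \<noteq> i\<close> test the rows in the same way, so only the entry
  of \<open>a\<close> at \<open>i, j\<close> remains.
\<close>

lemma lie_minimal_mat_unit:
  fixes I :: "'i set"
  assumes I: "infinite I" and ij: "i \<in> I" "j \<in> I" "i \<noteq> j"
  shows "lie_minimal I (mat_unit i j :: ('i, 'f::field) mat)"
  unfolding lie_minimal_def
proof (intro conjI ballI impI)
  let ?b = "mat_unit i j :: ('i, 'f) mat"
  show "?b \<in> sl_inf I" using ij by (rule mat_unit_in_sl_inf)
  show "?b \<noteq> 0" by (rule mat_unit_nonzero)
  fix a :: "('i, 'f) mat" assume a: "a \<in> sl_inf I" "almost_below I a ?b"
  obtain J where J: "finite J" "\<And>x k l. x \<in> sl_inf I \<Longrightarrow> lie_bracket ?b x = 0 \<Longrightarrow>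
      lie_bracket a x k l \<noteq> 0 \<Longrightarrow> k \<in> J \<and> l \<in> J"
    using a(2) unfolding almost_below_def bounded_support_def by blast
  obtain K where K: "finite K" "\<And>k l. a k l \<noteq> 0 \<Longrightarrow> k \<in> K \<and> l \<in> K"
    using M_fin_support[OF sl_inf_M_fin[OF a(1)]] by metis
  have fresh: "\<exists>k\<in>I. k \<notin> J \<and> k \<notin> K \<and> k \<noteq> i \<and> k \<noteq> j \<and> k \<noteq> m" for m
  proof -
    have "finite (J \<union> K \<union> {i, j, m})" using J K by simp
    then obtain k where "k \<in> I - (J \<union> K \<union> {i, j, m})"
      using I by (metis Diff_infinite_finite finite.emptyI ex_in_conv)
    then show ?thesis by blast
  qed
  have col: "a l m = 0" if "m \<noteq> j" for l m
  proof (cases "m \<in> I")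
    case True
    obtain k where k: "k \<in> I" "k \<notin> J" "k \<notin> K" "k \<noteq> i" "k \<noteq> j" "k \<noteq> m" using fresh by blast
    have "a k = 0" using K(2) k(3) by (auto simp: fun_eq_iff)
    then have "lie_bracket a (mat_unit m k) l k = a l m"
      by (simp add: lie_bracket_def mat_mult_unit mat_unit_mult) (simp add: outer_def unit_vec_def)
    moreover have "lie_bracket ?b (mat_unit m k) = 0"
      using k \<open>m \<noteq> j\<close> by (auto simp: lie_bracket_def mat_unit_mult_unit)
    moreover have "mat_unit m k \<in> sl_inf I"
      using mat_unit_in_sl_inf True k by metis
    ultimately show ?thesis using J(2) k(2) by metis
  next
    case False
    then show ?thesis using M_rcf_D(1)[OF sl_inf_M_rcf[OF a(1)]] by blast
  qed
  have row: "a m l = 0" if "m \<noteq> i" for l m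
  proof (cases "m \<in> I")
    case True
    obtain k where k: "k \<in> I" "k \<notin> J" "k \<notin> K" "k \<noteq> i" "k \<noteq> j" "k \<noteq> m" using fresh by blast
    have "(\<lambda>n. a n k) = 0" using K(2) k(3) by (auto simp: fun_eq_iff)
    then have "lie_bracket a (mat_unit k m) k l = - a m l"
      by (simp add: lie_bracket_def mat_mult_unit mat_unit_mult) (simp add: outer_def unit_vec_def)
    moreover have "lie_bracket ?b (mat_unit k m) = 0"
      using k \<open>m \<noteq> i\<close> by (auto simp: lie_bracket_def mat_unit_mult_unit)
    moreover have "mat_unit k m \<in> sl_inf I"
      using mat_unit_in_sl_inf True k by metis
    ultimately show ?thesis using J(2) k(2) by (metis neg_equal_0_iff_equal)
  next
    case False
    then show ?thesis using M_rcf_D(1)[OF sl_inf_M_rcf[OF a(1)]] by blast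
  qed
  have "a = mat_scale (a i j) ?b"
    using row col by (auto simp: mat_scale_def mat_unit_apply fun_eq_iff)
  then show "\<exists>c. a = mat_scale c ?b" ..
qed

text \<open>
  If \<open>x\<close> commutes with \<open>b\<close>, then \<open>[b c b, x] = b [c, x] b\<close>, whose rows and columns are
  combinations of those of \<open>b\<close>.
\<close>

lemma almost_below_sandwich:
  assumes b: "b \<in> sl_inf I" and c: "c \<in> M_fin I"
  shows "almost_below I (b \<star> c \<star> b) b"
proof -
  obtain J where J: "finite J" "\<And>i j. b i j \<noteq> 0 \<Longrightarrow> i \<in> J \<and> j \<in> J"
    using M_fin_support[OF sl_inf_M_fin[OF b]] by metis
  have "i \<in> J \<and> j \<in> J" if x: "x \<in> sl_inf I" "lie_bracket b x = 0"
    and nz: "lie_bracket (b \<star> c \<star> b) x i j \<noteq> 0" for x i j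
  proof -
    have R: "b \<in> M_rcf I" "c \<in> M_rcf I" "x \<in> M_rcf I"
      using sl_inf_M_rcf[OF b] sl_inf_M_rcf[OF x(1)] c M_fin_subset_M_rcf by auto
    note assoc = mat_mult_assoc[of _ I _ I] M_rcf_mult_closed[OF _ _] R
    have bx: "b \<star> x = x \<star> b" using x(2) by (simp add: lie_bracket_def)
    have "b \<star> c \<star> b \<star> x = b \<star> (c \<star> x) \<star> b"
      by (simp add: assoc bx)
    moreover have "x \<star> (b \<star> c \<star> b) = b \<star> (x \<star> c) \<star> b"
    proof -
      have "x \<star> (b \<star> c \<star> b) = (x \<star> b) \<star> (c \<star> b)" by (simp add: assoc)
      also have "\<dots> = (b \<star> x) \<star> (c \<star> b)" by (simp only: bx)
      also have "\<dots> = b \<star> (x \<star> c) \<star> b" by (simp add: assoc)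
      finally show ?thesis .
    qed
    ultimately have "(b \<star> (c \<star> x) \<star> b) i j \<noteq> 0 \<or> (b \<star> (x \<star> c) \<star> b) i j \<noteq> 0"
      using nz by (auto simp: lie_bracket_def)
    then show ?thesis
      using J(2) by (auto elim!: mat_mult_nonzeroE)
  qed
  then show ?thesis unfolding almost_below_def bounded_support_def using J(1) by blast
qed

text \<open>
  For a column \<open>v\<close> of \<open>b\<close> and a combination \<open>f\<close> of its rows, \<open>v \<otimes> f\<close> has the form \<open>b c b\<close> and is
  therefore almost below \<open>b\<close>. If it is nonzero and \<open>f v = 0\<close>, minimality makes \<open>b\<close> a multiple of it.
  Such an \<open>f\<close> fails to exist only if the rows of \<open>b\<close> are all proportional, and then \<open>b\<close> has rank
  one for that reason.
\<close>

lemma lie_minimal_outer: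
  assumes "lie_minimal I b"
  obtains u g where "b = outer u g"
proof -
  have b: "b \<in> sl_inf I" "b \<noteq> 0" and min: "\<And>a. a \<in> sl_inf I \<Longrightarrow> almost_below I a b \<Longrightarrow> \<exists>c. a = mat_scale c b"
    using assms by (auto simp: lie_minimal_def)
  obtain r s where rs: "b r s \<noteq> 0" using b(2) by (auto simp: fun_eq_iff)
  then have rsI: "r \<in> I" "s \<in> I" using M_rcf_D(1)[OF sl_inf_M_rcf[OF b(1)]] by blast+
  define v where "v = (\<lambda>i. b i s)"
  have v: "v \<in> vec_fin I" "v \<noteq> 0"
    using M_fin_row_col(1)[OF sl_inf_M_fin[OF b(1)]] rs by (auto simp: v_def fun_eq_iff)
  have rank_one: "\<exists>u g. b = outer u g"
    if f: "h \<in> vec_fin I" "f = (\<lambda>j. dot h (\<lambda>k. b k j))" "f \<noteq> 0" "dot f v = 0" for f h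
  proof -
    define c where "c = outer (unit_vec s) h"
    have c: "c \<in> M_fin I"
      unfolding c_def by (intro outer_in_M_fin unit_vec_in_vec_fin rsI f)
    have bcb: "b \<star> c \<star> b = outer v f"
      by (simp add: c_def mat_mult_outer outer_mat_mult dot_unit_vec v_def f(2))
    have "outer v f \<in> M_fin I"
      unfolding bcb[symmetric] by (intro M_fin_mult_closed sl_inf_M_fin b c)
    moreover have nz: "outer v f \<noteq> 0" using v f by (simp add: outer_eq_0_iff)
    ultimately have "f \<in> vec_fin I" by (rule outer_in_M_finD)
    then have "outer v f \<in> sl_inf I" using rsI(1) by (intro outer_in_sl_inf v(1) f(4)) auto
    then obtain d where d: "outer v f = mat_scale d b"
      using min almost_below_sandwich[OF b(1) c] unfolding bcb by blast
    then have "d \<noteq> 0" using nz by (auto simp: mat_scale_eq_0_iff)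
    then have "b = mat_scale (inverse d) (outer v f)" unfolding d by (simp add: mat_scale_def mult.assoc[symmetric])
    then show ?thesis unfolding mat_scale_outer(1) by blast
  qed
  have row: "b k = (\<lambda>j. dot (unit_vec k) (\<lambda>i. b i j))" for k
    by (simp add: dot_unit_vec)
  show thesis
  proof (cases "\<exists>i\<in>I. dot (b i) v \<noteq> 0")
    case False
    then show ?thesis
      using rank_one[OF unit_vec_in_vec_fin row] rs rsI that by (metis zero_fun_def)
  next
    case True
    then obtain i where i: "i \<in> I" "dot (b i) v \<noteq> 0" by blast
    \<comment> \<open>The combination of rows \<open>i\<close> and \<open>k\<close> of \<open>b\<close> with coefficients \<open>h k\<close> annihilates \<open>v\<close>.\<close>
    define p where "p = dot (b i) v"
    define h where "h k = (\<lambda>l. p * unit_vec k l - dot (b k) v * unit_vec i l)" for k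
    have h: "h k \<in> vec_fin I" if "k \<in> I" for k
      unfolding vec_fin_def h_def
      by (auto intro: rev_finite_subset[of "{k, i}"] simp: that i(1) unit_vec_def split: if_splits)
    have hb: "dot (h k) (\<lambda>l. b l j) = p * b k j - dot (b k) v * b i j" for k j
      unfolding h_def dot_diff_left[OF M_fin_row_col(1)[OF sl_inf_M_fin[OF b(1)]]]
        dot_mult_left dot_unit_vec ..
    show ?thesis
    proof (cases "\<exists>k\<in>I. (\<lambda>j. dot (h k) (\<lambda>l. b l j)) \<noteq> 0")
      case True
      then obtain k where k: "k \<in> I" "(\<lambda>j. dot (h k) (\<lambda>l. b l j)) \<noteq> 0" by blast
      have "dot (\<lambda>j. dot (h k) (\<lambda>l. b l j)) v = 0"
        unfolding hb dot_diff_left[OF v(1)] dot_mult_left p_def by simp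
      then show ?thesis using rank_one[OF h[OF k(1)] refl k(2)] that by blast
    next
      case False
      have entry: "b k j = dot (b k) v / p * b i j" for k j
      proof (cases "k \<in> I")
        case True
        then have "p * b k j - dot (b k) v * b i j = 0"
          using False hb by (metis zero_fun_def)
        then show ?thesis using i(2) by (simp add: p_def field_simps)
      next
        case False
        then have "b k = 0" using M_rcf_D(1)[OF sl_inf_M_rcf[OF b(1)]] by (auto simp: fun_eq_iff)
        then show ?thesis by (simp add: dot_def)
      qed
      have "b = outer (\<lambda>k. dot (b k) v / p) (b i)"
        unfolding outer_def by (intro ext) (rule entry)
      then show ?thesis using that by blast
    qed
  qed
qed

section \<open>Matrix units and their images\<close>

definition same_col :: "('i, 'f::field) mat \<Rightarrow> ('i, 'f) mat \<Rightarrow> bool" where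
  "same_col a b \<longleftrightarrow> (\<exists>u g h. a = outer u g \<and> b = outer u h)"

definition same_row :: "('i, 'f::field) mat \<Rightarrow> ('i, 'f) mat \<Rightarrow> bool" where
  "same_row a b \<longleftrightarrow> (\<exists>u v g. a = outer u g \<and> b = outer v g)"

lemma outer_eq_outerE:
  assumes eq: "outer u g = outer v h" and nz: "outer u g \<noteq> 0"
  obtains c where "v = (\<lambda>k. c * u k)" "g = (\<lambda>k. c * h k)"
proof -
  obtain i j where ij: "u i \<noteq> 0" "g j \<noteq> 0" using nz by (auto simp: outer_def fun_eq_iff)
  have e: "u k * g l = v k * h l" for k l using eq by (simp add: outer_def fun_eq_iff)
  have vh: "v i \<noteq> 0" "h j \<noteq> 0" using e[of i j] ij by auto
  have gh: "g = (\<lambda>l. v i / u i * h l)"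
  proof
    show "g l = v i / u i * h l" for l using e[of i l] ij by (simp add: field_simps)
  qed
  then have gj: "g j = v i / u i * h j" by metis
  have "v = (\<lambda>k. v i / u i * u k)"
  proof
    fix k
    have "v k * h j = v i / u i * u k * h j"
      using e[of k j] unfolding gj by (simp add: mult.commute mult.left_commute)
    then show "v k = v i / u i * u k" using vh(2) by (simp only: mult_cancel_right) simp
  qed
  then show thesis using gh by (rule that)
qed

lemma same_col_outerE:
  assumes "same_col (outer u g) b" "outer u g \<noteq> 0"
  obtains h where "b = outer u h"
proof -
  obtain v k h where v: "outer u g = outer v k" "b = outer v h"
    using assms(1) by (auto simp: same_col_def)
  obtain c where "v = (\<lambda>k. c * u k)" using outer_eq_outerE[OF v(1) assms(2)] .
  then have "b = outer u (\<lambda>k. c * h k)" using v(2) by (simp add: mat_scale_outer[symmetric])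
  then show ?thesis by (rule that)
qed

lemma same_row_outerE:
  assumes "same_row (outer u g) b" "outer u g \<noteq> 0"
  obtains v where "b = outer v g"
proof -
  obtain w k v where v: "outer w k = outer u g" "b = outer v k"
    using assms(1) unfolding same_row_def by metis
  obtain c where "k = (\<lambda>l. c * g l)" using outer_eq_outerE[OF v(1)] assms(2) v(1) by metis
  then have "b = outer (\<lambda>k. c * v k) g" using v(2) by (simp add: mat_scale_outer[symmetric])
  then show ?thesis by (rule that)
qed

lemma same_col_sym: "same_col a b \<Longrightarrow> same_col b a"
  unfolding same_col_def by blast

lemma same_row_sym: "same_row a b \<Longrightarrow> same_row b a"
  unfolding same_row_def by blast

lemma same_col_trans:
  assumes "same_col a b" "same_col b c" "b \<noteq> 0"
  shows "same_col a c"
proof -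
  obtain u g h where u: "a = outer u g" "b = outer u h" using assms(1) by (auto simp: same_col_def)
  obtain k where "c = outer u k" using same_col_outerE assms(2,3) u(2) by metis
  then show ?thesis using u(1) by (auto simp: same_col_def)
qed

lemma same_row_trans:
  assumes "same_row a b" "same_row b c" "b \<noteq> 0"
  shows "same_row a c"
proof -
  obtain u v g where u: "a = outer u g" "b = outer v g" using assms(1) by (auto simp: same_row_def)
  obtain w where "c = outer w g" using same_row_outerE assms(2,3) u(2) by metis
  then show ?thesis using u(1) by (auto simp: same_row_def)
qed

lemma same_col_same_row_proportional:
  assumes "same_col a b" "same_row a b" "a \<noteq> 0"
  obtains c where "b = mat_scale c a"
proof (cases "b = 0")
  case True
  then show ?thesis using that[of 0] by simp
next
  case False
  obtain u g h where u: "a = outer u g" "b = outer u h" using assms(1) by (auto simp: same_col_def)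
  obtain v where v: "b = outer v g" using same_row_outerE assms(2,3) u(1) by metis
  obtain c where "v = (\<lambda>k. c * u k)"
    using outer_eq_outerE[of u h v g] False u(2) v by metis
  then have "b = mat_scale c a" using v u(1) by (simp add: mat_scale_outer(1))
  then show ?thesis by (rule that)
qed

text \<open>
  Write \<open>\<alpha> = g v\<close> and \<open>\<beta> = h u\<close>, so that the bracket is \<open>\<alpha> (u \<otimes> h) - \<beta> (v \<otimes> g)\<close>. If neither
  scalar vanished, \<open>u\<close> and \<open>v\<close> would be eigenvectors of the bracket for the nonzero values
  \<open>\<alpha> \<beta>\<close> and \<open>- \<alpha> \<beta>\<close>; rank one then makes \<open>v\<close> a multiple of \<open>u\<close>, contradicting \<open>g u = 0\<close>.
\<close>

lemma lie_bracket_outer_rank_one: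
  assumes fin: "u \<in> vec_fin I" "v \<in> vec_fin I" and tr: "dot g u = 0" "dot h v = 0"
    and rank1: "lie_bracket (outer u g) (outer v h) = outer w k"
  defines "p \<equiv> lie_bracket (outer u g) (outer v h)"
  shows "(same_col (outer u g) p \<and> same_row (outer v h) p) \<or>
    (same_row (outer u g) p \<and> same_col (outer v h) p)"
proof -
  let ?\<alpha> = "dot g v" and ?\<beta> = "dot h u"
  have p: "p = mat_scale ?\<alpha> (outer u h) - mat_scale ?\<beta> (outer v g)"
    unfolding p_def by (rule lie_bracket_outer)
  consider "?\<beta> = 0" | "?\<alpha> = 0" | "?\<alpha> \<noteq> 0" "?\<beta> \<noteq> 0" by blast
  then show ?thesis
  proof cases
    case 1
    then have "p = mat_scale ?\<alpha> (outer u h)" using p by simp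
    then show ?thesis
      unfolding same_col_def same_row_def using mat_scale_outer by metis
  next
    case 2
    then have "p = mat_scale (- ?\<beta>) (outer v g)" using p by simp
    then show ?thesis
      unfolding same_col_def same_row_def using mat_scale_outer by metis
  next
    case 3
    have e: "?\<alpha> * u i * dot h x - ?\<beta> * v i * dot g x = w i * dot k x" if x: "x \<in> vec_fin I" for i x
    proof -
      have "w i * dot k x = dot (\<lambda>j. outer w k i j) x"
        by (simp add: outer_def dot_mult_left)
      also have "\<dots> = dot (\<lambda>j. ?\<alpha> * u i * h j - ?\<beta> * v i * g j) x"
        unfolding rank1[symmetric] lie_bracket_outer
        by (simp add: mat_scale_def outer_def mult.assoc)
      also have "\<dots> = ?\<alpha> * u i * dot h x - ?\<beta> * v i * dot g x"
        by (simp only: dot_diff_left[OF x] dot_mult_left)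
      finally show ?thesis ..
    qed
    have eu: "?\<alpha> * ?\<beta> * u i = w i * dot k u" for i
      using e[OF fin(1), of i] tr by (simp add: mult.commute mult.left_commute)
    have ev: "- (?\<alpha> * ?\<beta>) * v i = w i * dot k v" for i
      using e[OF fin(2), of i] tr by (simp add: mult.commute mult.left_commute)
    have "dot k u \<noteq> 0"
    proof
      assume "dot k u = 0"
      then have "u = (\<lambda>i. 0)" using eu 3 by (simp add: fun_eq_iff)
      then show False using 3(2) by (simp add: dot_def)
    qed
    have "v i = - dot k v / dot k u * u i" for i
    proof -
      have "(?\<alpha> * ?\<beta>) * (v i * dot k u) = (?\<alpha> * ?\<beta>) * (- dot k v * u i)"
        using eu[of i] ev[of i] by algebra
      then have "v i * dot k u = - dot k v * u i" using 3 by (simp only: mult_cancel_left) simp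
      then show ?thesis using \<open>dot k u \<noteq> 0\<close> by (simp add: field_simps)
    qed
    then have "v = (\<lambda>i. - dot k v / dot k u * u i)" by blast
    then have "?\<alpha> = - dot k v / dot k u * dot g u" using dot_mult_right by metis
    then show ?thesis using 3(1) tr(1) by simp
  qed
qed

lemma infinite_fresh_element: "infinite I \<Longrightarrow> finite F \<Longrightarrow> \<exists>p. p \<in> I \<and> p \<notin> F"
  by (meson finite_subset subsetI)

text \<open>
  By the chain condition the last index can be exchanged, and by the swaps any index can be moved
  to the last place. Two triples that may overlap are compared through a pair \<open>p, q\<close> that avoids
  both of them.
\<close>

lemma constant_on_triples:
  assumes I: "infinite I"
    and swap: "\<And>i j k. {i, j, k} \<subseteq> I \<Longrightarrow> distinct [i, j, k] \<Longrightarrow> T i j k = T i k j"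
      "\<And>i j k. {i, j, k} \<subseteq> I \<Longrightarrow> distinct [i, j, k] \<Longrightarrow> T i j k = T j i k"
    and chain: "\<And>i j k l. {i, j, k, l} \<subseteq> I \<Longrightarrow> distinct [i, j, k, l] \<Longrightarrow> T i j k = T i j l"
    and ijk: "{i, j, k} \<subseteq> I" "distinct [i, j, k]"
    and abc: "{a, b, c} \<subseteq> I" "distinct [a, b, c]"
  shows "T i j k = T a b c"
proof -
  obtain p where p: "p \<in> I - {i, j, k, a, b, c}"
    using infinite_fresh_element[OF I, of "{i, j, k, a, b, c}"] by auto
  obtain q where q: "q \<in> I - {i, j, k, a, b, c, p}"
    using infinite_fresh_element[OF I, of "{i, j, k, a, b, c, p}"] by auto
  have *: "T i j k = T p q i" if "{i, j, k} \<subseteq> I" "distinct [i, j, k]" "p \<in> I - {i, j, k}"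
    "q \<in> I - {i, j, k, p}" for i j k
  proof -
    have "T i j k = T i j p" using chain[of i j k p] that by auto
    also have "\<dots> = T i p j" using swap(1)[of i j p] that by auto
    also have "\<dots> = T i p q" using chain[of i p j q] that by auto
    also have "\<dots> = T p i q" using swap(2)[of i p q] that by auto
    also have "\<dots> = T p q i" using swap(1)[of p i q] that by auto
    finally show ?thesis .
  qed
  have "T i j k = T p q i" by (rule *) (use ijk p q in auto)
  moreover have "T a b c = T p q a" by (rule *) (use abc p q in auto)
  moreover have "T p q i = T p q a" if "i \<noteq> a"
    using chain[of p q i a] that ijk abc p q by auto
  ultimately show ?thesis by (cases "i = a") auto
qed

context
  fixes I :: "'i set" and \<phi> :: "('i, 'f::field) mat \<Rightarrow> ('i, 'f) mat"
  assumes I: "infinite I" and aut: "lie_automorphism (sl_inf I) \<phi>"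
begin

abbreviation (input) image_unit :: "'i \<Rightarrow> 'i \<Rightarrow> ('i, 'f) mat" where
  "image_unit i j \<equiv> \<phi> (mat_unit i j)"

lemma image_unit_in_sl_inf: "i \<in> I \<Longrightarrow> j \<in> I \<Longrightarrow> i \<noteq> j \<Longrightarrow> image_unit i j \<in> sl_inf I"
  by (intro automorphism_in[OF aut] mat_unit_in_sl_inf)

lemma image_unit_nonzero: "i \<in> I \<Longrightarrow> j \<in> I \<Longrightarrow> i \<noteq> j \<Longrightarrow> image_unit i j \<noteq> 0"
  by (simp add: automorphism_eq_0_iff[OF aut mat_unit_in_sl_inf] mat_unit_nonzero)

lemma image_unit_outerE:
  assumes "i \<in> I" "j \<in> I" "i \<noteq> j"
  obtains u g where "image_unit i j = outer u g" "u \<in> vec_fin I" "g \<in> vec_fin I" "dot g u = 0"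
proof -
  obtain u g where ug: "image_unit i j = outer u g"
    using lie_minimal_outer[OF lie_minimal_automorphism[OF aut lie_minimal_mat_unit[OF I assms]]] .
  have "outer u g \<in> sl_inf I" "outer u g \<noteq> 0"
    using image_unit_in_sl_inf image_unit_nonzero assms unfolding ug[symmetric] by auto
  then show ?thesis
    using that[OF ug] outer_in_M_finD sl_inf_M_fin dot_eq_0_of_outer_in_sl_inf by blast
qed

lemma image_unit_bracket:
  assumes "i \<in> I" "j \<in> I" "k \<in> I" "i \<noteq> j" "j \<noteq> k" "i \<noteq> k"
  shows "lie_bracket (image_unit i j) (image_unit j k) = image_unit i k"
proof -
  have "lie_bracket (mat_unit i j) (mat_unit j k) = (mat_unit i k :: ('i, 'f) mat)"
    using assms by (simp add: lie_bracket_def mat_unit_mult_unit)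
  then show ?thesis
    using automorphism_bracket[OF aut mat_unit_in_sl_inf mat_unit_in_sl_inf, of i j j k] assms by simp
qed

text \<open>
  The first alternative says that \<open>\<phi> (E i k)\<close> is proportional to \<open>\<phi> (E i j) \<phi> (E j k)\<close>, the second
  that it is proportional to the product in the opposite order.
\<close>

lemma image_unit_triangle:
  assumes "i \<in> I" "j \<in> I" "k \<in> I" "i \<noteq> j" "j \<noteq> k" "i \<noteq> k"
  shows "(same_col (image_unit i j) (image_unit i k) \<and> same_row (image_unit j k) (image_unit i k)) \<or>
    (same_row (image_unit i j) (image_unit i k) \<and> same_col (image_unit j k) (image_unit i k))"
proof -
  obtain u g where u: "image_unit i j = outer u g" "u \<in> vec_fin I" "dot g u = 0"
    using image_unit_outerE assms by metis
  obtain v h where v: "image_unit j k = outer v h" "v \<in> vec_fin I" "dot h v = 0"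
    using image_unit_outerE assms by metis
  obtain w l where w: "image_unit i k = outer w l" using image_unit_outerE assms by metis
  have "lie_bracket (outer u g) (outer v h) = image_unit i k"
    using image_unit_bracket[OF assms] u(1) v(1) by simp
  then show ?thesis
    using lie_bracket_outer_rank_one[OF u(2) v(2) u(3) v(3)] w u(1) v(1) by simp
qed

lemma image_units_not_proportional:
  assumes "i \<in> I" "j \<in> I" "i \<noteq> j" "k \<in> I" "l \<in> I" "k \<noteq> l" "(i, j) \<noteq> (k, l)"
  shows "\<not> (same_col (image_unit i j) (image_unit k l) \<and> same_row (image_unit i j) (image_unit k l))"
proof
  assume "same_col (image_unit i j) (image_unit k l) \<and> same_row (image_unit i j) (image_unit k l)"
  then obtain c where "image_unit k l = mat_scale c (image_unit i j)"
    using same_col_same_row_proportional image_unit_nonzero assms by metis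
  then have "\<phi> (mat_unit k l) = \<phi> (mat_scale c (mat_unit i j))"
    using automorphism_scale[OF aut] mat_unit_in_sl_inf assms by metis
  then have "(mat_unit k l :: ('i, 'f) mat) = mat_scale c (mat_unit i j)"
    using automorphism_eq_iff[OF aut] mat_unit_in_sl_inf assms mat.subspace_scale[OF subspace_sl_inf]
    by metis
  then have "(mat_unit k l :: ('i, 'f) mat) k l = mat_scale c (mat_unit i j) k l" by simp
  then show False using assms by (simp add: mat_scale_def mat_unit_apply split: if_splits)
qed

text \<open>
  The images of two different units are not proportional, so the alternatives for a triple exclude
  each other. This makes the type of a triple independent of the order of its indices. If triples
  \<open>i, j, k\<close> and \<open>i, j, l\<close> had different types, then whichever type \<open>i, k, l\<close> has, transitivity
  would show that two different images with first index \<open>i\<close> share both their column and their row.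
\<close>

lemma image_unit_type:
  assumes "{i, j, k} \<subseteq> I" "distinct [i, j, k]" "{a, b, c} \<subseteq> I" "distinct [a, b, c]"
  shows "same_col (image_unit i j) (image_unit i k) \<longleftrightarrow> same_col (image_unit a b) (image_unit a c)"
proof (rule constant_on_triples[OF I, where T = "\<lambda>i j k. same_col (image_unit i j) (image_unit i k)"])
  show "same_col (image_unit i j) (image_unit i k) = same_col (image_unit i k) (image_unit i j)" for i j k
    using same_col_sym by blast
  have half: "same_col (image_unit j i) (image_unit j k)"
    if ijk: "{i, j, k} \<subseteq> I" "distinct [i, j, k]" and T: "same_col (image_unit i j) (image_unit i k)" for i j k
  proof -
    have "same_row (image_unit j k) (image_unit i k)"
      using image_unit_triangle[of i j k] image_units_not_proportional[of i j i k] T ijk by auto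
    then show ?thesis
      using image_unit_triangle[of j i k] image_units_not_proportional[of i k j k] ijk
      by (auto dest: same_row_sym)
  qed
  show "same_col (image_unit i j) (image_unit i k) = same_col (image_unit j i) (image_unit j k)"
    if "{i, j, k} \<subseteq> I" "distinct [i, j, k]" for i j k
    using half[of i j k] half[of j i k] that by auto
  have half: "same_col (image_unit i j) (image_unit i l)"
    if ijkl: "{i, j, k, l} \<subseteq> I" "distinct [i, j, k, l]" and T: "same_col (image_unit i j) (image_unit i k)"
    for i j k l
  proof (rule ccontr)
    assume no: "\<not> ?thesis"
    then have row: "same_row (image_unit i j) (image_unit i l)"
      using image_unit_triangle[of i j l] ijkl by auto
    have nz: "image_unit i k \<noteq> 0" "image_unit i l \<noteq> 0" using image_unit_nonzero ijkl by auto
    have "\<not> same_col (image_unit i k) (image_unit i l)"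
      using same_col_trans[OF T _ nz(1)] no by blast
    then have "same_row (image_unit i k) (image_unit i l)"
      using image_unit_triangle[of i k l] ijkl by auto
    then have "same_row (image_unit i j) (image_unit i k)"
      using same_row_trans[OF row same_row_sym nz(2)] by blast
    then show False using image_units_not_proportional[of i j i k] T ijkl by auto
  qed
  show "same_col (image_unit i j) (image_unit i k) = same_col (image_unit i j) (image_unit i l)"
    if "{i, j, k, l} \<subseteq> I" "distinct [i, j, k, l]" for i j k l
    using half[of i j k l] half[of i j l k] that by auto
qed (use assms in auto)

text \<open>
  Fix an index \<open>o'\<close>. The vectors \<open>u i\<close> are read off the images of the units \<open>E i o'\<close>, the functionals
  \<open>g j\<close> off those of \<open>E o' j\<close>. Each other image is a multiple of \<open>u i \<otimes> g j\<close>, so trace zero gives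
  \<open>g j (u i) = 0\<close>, and the relation \<open>[E i o', E o' j] = E i j\<close> then shows that the factor is the same
  scalar for all of them. It is absorbed into the functionals with \<open>j \<noteq> o'\<close> and compensated in the
  vector for \<open>o'\<close>.
\<close>

lemma image_units_in_coordinates:
  assumes type: "\<And>i j k. {i, j, k} \<subseteq> I \<Longrightarrow> distinct [i, j, k] \<Longrightarrow>
    same_col (image_unit i j) (image_unit i k)"
  obtains u g where "\<And>i j. i \<in> I \<Longrightarrow> j \<in> I \<Longrightarrow> i \<noteq> j \<Longrightarrow> image_unit i j = outer (u i) (g j)"
proof -
  have row: "same_row (image_unit j k) (image_unit i k)" if "{i, j, k} \<subseteq> I" "distinct [i, j, k]" for i j k
    using image_unit_triangle[of i j k] image_units_not_proportional[of i j i k] type[of i j k] that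
    by auto
  obtain o' where o: "o' \<in> I" using infinite_fresh_element[OF I, of "{}"] by auto
  obtain p where p: "p \<in> I" "p \<noteq> o'" using infinite_fresh_element[OF I, of "{o'}"] by auto
  obtain x g0 where x: "image_unit p o' = outer x g0" using image_unit_outerE o p by metis
  obtain u0 y where y: "image_unit o' p = outer u0 y" using image_unit_outerE o p by metis
  have "\<exists>w. image_unit i o' = outer w g0" if "i \<in> I" "i \<noteq> o'" for i
  proof (cases "i = p")
    case False
    then have "same_row (outer x g0) (image_unit i o')" using row[of i p o'] that o p x by simp
    moreover have "outer x g0 \<noteq> 0" using image_unit_nonzero[of p o'] o p x by simp
    ultimately show ?thesis using same_row_outerE by metis
  qed (use x in blast)
  then obtain u where u: "\<And>i. i \<in> I \<Longrightarrow> i \<noteq> o' \<Longrightarrow> image_unit i o' = outer (u i) g0" by metis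
  have "\<exists>h. image_unit o' j = outer u0 h" if "j \<in> I" "j \<noteq> o'" for j
  proof (cases "j = p")
    case False
    then have "same_col (outer u0 y) (image_unit o' j)" using type[of o' p j] that o p y by simp
    moreover have "outer u0 y \<noteq> 0" using image_unit_nonzero[of o' p] o p y by simp
    ultimately show ?thesis using same_col_outerE by metis
  qed (use y in blast)
  then obtain g where g: "\<And>j. j \<in> I \<Longrightarrow> j \<noteq> o' \<Longrightarrow> image_unit o' j = outer u0 (g j)" by metis
  let ?d = "dot g0 u0"
  have others: "image_unit i j = mat_scale ?d (outer (u i) (g j))"
    if ij: "i \<in> I" "j \<in> I" "i \<noteq> j" "i \<noteq> o'" "j \<noteq> o'" for i j
  proof -
    have nz: "outer (u i) g0 \<noteq> 0" "outer u0 (g j) \<noteq> 0" "image_unit i j \<noteq> 0"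
      using image_unit_nonzero[of i o'] image_unit_nonzero[of o' j] image_unit_nonzero[of i j] u g ij o
      by auto
    have "same_col (outer (u i) g0) (image_unit i j)"
      using type[of i o' j] u ij o by auto
    then obtain h where h: "image_unit i j = outer (u i) h"
      using same_col_outerE nz(1) by metis
    have "same_row (outer u0 (g j)) (image_unit i j)"
      using row[of i o' j] g ij o by auto
    then obtain v where v: "image_unit i j = outer v (g j)"
      using same_row_outerE nz(2) by metis
    obtain c where c: "h = (\<lambda>k. c * g j k)"
      using outer_eq_outerE[of "u i" h v "g j"] h v nz(3) by metis
    have "dot h (u i) = 0"
      using dot_eq_0_of_outer_in_sl_inf image_unit_in_sl_inf[of i j] h ij by metis
    moreover have "c \<noteq> 0" using h nz(3) c by (auto simp: outer_def fun_eq_iff)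
    ultimately have "dot (g j) (u i) = 0" by (simp add: c dot_mult_left)
    then show ?thesis
      using image_unit_bracket[of i o' j] u g ij o by (simp add: lie_bracket_outer)
  qed
  obtain q where q: "q \<in> I" "q \<noteq> o'" "q \<noteq> p"
    using infinite_fresh_element[OF I, of "{o', p}"] by auto
  have "?d \<noteq> 0" using others[of p q] image_unit_nonzero[of p q] p q by auto
  show ?thesis
  proof (rule that)
    let ?u = "\<lambda>i. if i = o' then (\<lambda>k. u0 k / ?d) else u i"
    let ?g = "\<lambda>j. if j = o' then g0 else (\<lambda>k. ?d * g j k)"
    show "image_unit i j = outer (?u i) (?g j)" if "i \<in> I" "j \<in> I" "i \<noteq> j" for i j
      using u g others \<open>?d \<noteq> 0\<close> that by (auto simp: mat_scale_outer(2)) (simp add: outer_def)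
  qed
qed

end

section \<open>Reconstruction of the conjugating matrix\<close>

text \<open>
  Duality comes from the Lie algebra: \<open>u i \<otimes> g j\<close> has trace zero for \<open>i \<noteq> j\<close>, and
  \<open>[E i j, E j k] = E i k\<close> forces \<open>g j (u j) = 1\<close>. A priori only the columns of \<open>U\<close> and the rows of
  \<open>G\<close> are finite. Since \<open>\<phi>\<close> is surjective, each unit \<open>E k l\<close> with \<open>k \<noteq> l\<close> equals \<open>U a G\<close> with \<open>a\<close>
  finitary; with \<open>G U = 1\<close> this gives \<open>E k l U = U a\<close> and \<open>G E k l = a G\<close>, so the rows of \<open>U\<close> and the
  columns of \<open>G\<close> are finite, and \<open>U G E k l = U a G = E k l\<close>, so \<open>U G = 1\<close>.
\<close>

lemma dual_bases_conjugation:
  fixes I :: "'i set" and \<phi> :: "('i, 'f::field) mat \<Rightarrow> ('i, 'f) mat"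
  assumes I: "infinite I" and aut: "lie_automorphism (sl_inf I) \<phi>"
    and coords: "\<And>i j. i \<in> I \<Longrightarrow> j \<in> I \<Longrightarrow> i \<noteq> j \<Longrightarrow> \<phi> (mat_unit i j) = outer (u i) (g j)"
  obtains x where "x \<in> carrier (GL_rcf I)" "\<And>a. a \<in> sl_inf I \<Longrightarrow> \<phi> a = inv\<^bsub>GL_rcf I\<^esub> x \<star> a \<star> x"
proof -
  let ?L = "sl_inf I :: ('i, 'f) mat set"
  have other: "\<exists>j\<in>I. j \<noteq> i \<and> j \<noteq> k" for i k
    using infinite_fresh_element[OF I, of "{i, k}"] by auto
  have nz: "outer (u i) (g j) \<noteq> 0" and in_L: "outer (u i) (g j) \<in> ?L"
    if "i \<in> I" "j \<in> I" "i \<noteq> j" for i j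
    using coords[OF that] image_unit_nonzero[OF I aut that] image_unit_in_sl_inf[OF I aut that] by simp_all
  have u: "u i \<in> vec_fin I" if "i \<in> I" for i
    using other[of i i] outer_in_M_finD(1)[OF sl_inf_M_fin[OF in_L] nz] that by metis
  have g: "g j \<in> vec_fin I" if "j \<in> I" for j
    using other[of j j] outer_in_M_finD(2)[OF sl_inf_M_fin[OF in_L] nz] that by metis
  have orth: "dot (g j) (u i) = 0" if "i \<in> I" "j \<in> I" "i \<noteq> j" for i j
    using dot_eq_0_of_outer_in_sl_inf[OF in_L[OF that]] .
  have norm: "dot (g j) (u j) = 1" if j: "j \<in> I" for j
  proof -
    obtain i where i: "i \<in> I" "i \<noteq> j" using other by blast
    obtain k where k: "k \<in> I" "k \<noteq> j" "k \<noteq> i" using other[of j i] by blast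
    have ne: "i \<noteq> j" "j \<noteq> k" "i \<noteq> k" using i k by auto
    have "lie_bracket (outer (u i) (g j)) (outer (u j) (g k)) = outer (u i) (g k)"
      using image_unit_bracket[OF I aut i(1) j k(1) ne] coords i(1) j k(1) ne by simp
    then have e: "mat_scale (dot (g j) (u j)) (outer (u i) (g k)) = outer (u i) (g k)"
      using orth[OF i(1) k(1) ne(3)] by (simp add: lie_bracket_outer)
    obtain m n where "outer (u i) (g k) m n \<noteq> 0"
      using nz[OF i(1) k(1) ne(3)] by (metis ext zero_fun_def)
    then show ?thesis using fun_cong[OF fun_cong[OF e, of m], of n] by (simp add: mat_scale_def)
  qed

  define U :: "('i, 'f) mat" where "U = (\<lambda>k i. if i \<in> I then u i k else 0)"
  define G :: "('i, 'f) mat" where "G = (\<lambda>j l. if j \<in> I then g j l else 0)"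
  have U_col: "(\<lambda>k. U k i) \<in> vec_fin I" for i
    using u[of i] by (auto simp: U_def vec_fin_def)
  have G_row: "G j \<in> vec_fin I" for j
    using g[of j] by (auto simp: G_def vec_fin_def)
  have GU: "G \<star> U = mat_one I"
  proof (intro ext)
    fix j i
    show "(G \<star> U) j i = mat_one I j i"
    proof (cases "i \<in> I \<and> j \<in> I")
      case True
      then have "(G \<star> U) j i = dot (g j) (u i)"
        by (simp add: mat_mult_def G_def U_def dot_def)
      then show ?thesis using True orth norm by (auto simp: mat_one_def)
    next
      case False
      then have "(G \<star> U) j i = 0" by (auto simp: mat_mult_def G_def U_def)
      then show ?thesis using False by (auto simp: mat_one_def)
    qed
  qed
  have Ua: "U \<star> a \<in> M_fin I" if "a \<in> M_fin I" for a
    by (rule mat_mult_in_M_fin_left[OF U_col that])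
  have aG: "a \<star> G \<in> M_fin I" if "a \<in> M_fin I" for a
    by (rule mat_mult_in_M_fin_right[OF G_row that])
  have unit: "U \<star> mat_unit i j \<star> G = outer (u i) (g j)" if "i \<in> I" "j \<in> I" for i j
    using that by (simp add: mat_mult_unit outer_mat_mult dot_unit_vec) (simp add: U_def G_def)

  have \<phi>_eq: "\<phi> a = U \<star> a \<star> G" if a: "a \<in> ?L" for a
  proof -
    have gens: "(sl_gens I :: ('i, 'f) mat set) \<subseteq> ?L"
      by (auto simp: sl_gens_def intro!: mat_unit_in_sl_inf sl_inf_bracket_closed)
    have "\<phi> a - U \<star> a \<star> G \<in> {0}"
    proof (rule linear_image_of_span[OF subspace_sl_inf mat.subspace_single_0 gens,
          where f = "\<lambda>a. \<phi> a - U \<star> a \<star> G"])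
      show "a \<in> mat.span (sl_gens I)" using sl_inf_subset_span_gens a by blast
      show "\<phi> (a + b) - U \<star> (a + b) \<star> G = (\<phi> a - U \<star> a \<star> G) + (\<phi> b - U \<star> b \<star> G)"
        if "a \<in> ?L" "b \<in> ?L" for a b
        using that automorphism_add[OF aut that] mat_mult_add_right[OF that[THEN sl_inf_M_fin], of U]
          mat_mult_add_left[OF that[THEN sl_inf_M_fin, THEN Ua], of G] by simp
      show "\<phi> (mat_scale c a) - U \<star> mat_scale c a \<star> G = mat_scale c (\<phi> a - U \<star> a \<star> G)"
        if "a \<in> ?L" for c a
        using automorphism_scale[OF aut that] by (simp add: mat_mult_scale mat_scale_diff)
      fix b :: "('i, 'f) mat" assume "b \<in> sl_gens I"
      then consider i j where "i \<in> I" "j \<in> I" "i \<noteq> j" "b = mat_unit i j"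
        | i j where "i \<in> I" "j \<in> I" "i \<noteq> j" "b = lie_bracket (mat_unit i j) (mat_unit j i)"
        unfolding sl_gens_def by blast
      then show "\<phi> b - U \<star> b \<star> G \<in> {0}"
      proof cases
        case 1
        then show ?thesis using coords unit by simp
      next
        case (2 i j)
        note [simp] = 2(1-3) 2(3)[symmetric]
        have fin: "(mat_unit i i :: ('i, 'f) mat) \<in> M_fin I" "(mat_unit j j :: ('i, 'f) mat) \<in> M_fin I"
          by (simp_all add: mat_unit_in_M_fin)
        have b: "b = mat_unit i i - mat_unit j j"
          unfolding 2(4) by (simp add: lie_bracket_def mat_unit_mult_unit)
        have "U \<star> b \<star> G = outer (u i) (g i) - outer (u j) (g j)"
          unfolding b mat_mult_diff_right[OF fin] mat_mult_diff_left[OF fin[THEN Ua]] by (simp add: unit)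
        moreover have "\<phi> b = outer (u i) (g i) - outer (u j) (g j)"
          unfolding 2(4)
          by (simp add: automorphism_bracket[OF aut] mat_unit_in_sl_inf coords lie_bracket_outer norm)
        ultimately show ?thesis by simp
      qed
    qed
    then show ?thesis by simp
  qed

  have unit_hit: "\<exists>a \<in> M_fin I. mat_unit k l = U \<star> a \<star> G" if kl: "k \<in> I" "l \<in> I" "k \<noteq> l" for k l
  proof -
    obtain a where "a \<in> ?L" "\<phi> a = mat_unit k l"
      using automorphism_surj[OF aut mat_unit_in_sl_inf[OF kl]] .
    then show ?thesis using \<phi>_eq sl_inf_M_fin by metis
  qed
  have U_fin: "finite {k. U k i \<noteq> 0}" for i using U_col by (simp add: vec_fin_def)
  have G_fin: "finite {l. G j l \<noteq> 0}" for j using G_row by (simp add: vec_fin_def)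
  have U_row_fin: "finite {i. U k i \<noteq> 0}" for k
  proof (cases "k \<in> I")
    case True
    then obtain l where l: "l \<in> I" "l \<noteq> k" using other by blast
    obtain a where a: "a \<in> M_fin I" "mat_unit l k = U \<star> a \<star> G" using unit_hit[OF l(1) True l(2)] by blast
    have "mat_unit l k \<star> U = (U \<star> a) \<star> (G \<star> U)"
      unfolding a(2) by (rule mat_mult_assoc_row_col[OF M_rcf_D(2) U_fin])
        (use Ua[OF a(1)] M_fin_subset_M_rcf in blast)
    also have "\<dots> = U \<star> a"
      unfolding GU using mat_one_right Ua[OF a(1)] M_fin_subset_M_rcf by blast
    finally have prod: "mat_unit l k \<star> U = U \<star> a" .
    have row: "U k = (U \<star> a) l"
      unfolding prod[symmetric] mat_unit_mult by (simp add: outer_def unit_vec_def)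
    show ?thesis
      unfolding row using M_fin_row_col(2)[OF Ua[OF a(1)], of l] by (simp add: vec_fin_def)
  next
    case False
    have "U k i = 0" for i using U_col[of i] False by (auto simp: vec_fin_def)
    then show ?thesis by simp
  qed
  have G_unit: "\<exists>a \<in> M_fin I. G \<star> mat_unit k l = a \<star> G \<and> U \<star> (a \<star> G) = mat_unit k l"
    if kl: "k \<in> I" "l \<in> I" "k \<noteq> l" for k l
  proof -
    obtain a where a: "a \<in> M_fin I" "mat_unit k l = U \<star> a \<star> G" using unit_hit[OF kl] by blast
    have "G \<star> mat_unit k l = (G \<star> (U \<star> a)) \<star> G"
      unfolding a(2) by (rule mat_mult_assoc_middle[OF Ua[OF a(1)], symmetric])
    also have "G \<star> (U \<star> a) = (G \<star> U) \<star> a"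
      by (rule mat_mult_assoc_row_col[symmetric, OF G_fin M_rcf_D(3)])
        (use a(1) M_fin_subset_M_rcf in blast)
    also have "\<dots> = a"
      unfolding GU using mat_one_left a(1) M_fin_subset_M_rcf by blast
    finally show ?thesis
      using a mat_mult_assoc_middle[OF a(1), of U G] by auto
  qed
  have G_col_fin: "finite {j. G j k \<noteq> 0}" for k
  proof (cases "k \<in> I")
    case True
    then obtain l where l: "l \<in> I" "k \<noteq> l" using other by blast
    obtain a where a: "a \<in> M_fin I" "G \<star> mat_unit k l = a \<star> G" using G_unit[OF True l] by blast
    have col: "(\<lambda>j. G j k) = (\<lambda>j. (a \<star> G) j l)"
      unfolding a(2)[symmetric] by (simp add: mat_mult_unit) (simp add: outer_def unit_vec_def)
    show ?thesis
      using M_fin_row_col(1)[OF aG[OF a(1)], of l] unfolding col[symmetric] by (simp add: vec_fin_def)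
  next
    case False
    have "G j k = 0" for j using G_row[of j] False by (auto simp: vec_fin_def)
    then show ?thesis by simp
  qed
  have U_rcf: "U \<in> M_rcf I"
  proof (rule M_rcf_I[OF _ U_row_fin U_fin])
    show "i \<in> I \<and> j \<in> I" if "U i j \<noteq> 0" for i j
      using that u[of j] by (auto simp: U_def vec_fin_def split: if_splits)
  qed
  have G_rcf: "G \<in> M_rcf I"
  proof (rule M_rcf_I[OF _ G_fin G_col_fin])
    show "i \<in> I \<and> j \<in> I" if "G i j \<noteq> 0" for i j
      using that g[of i] by (auto simp: G_def vec_fin_def split: if_splits)
  qed
  have UG: "U \<star> G = mat_one I"
  proof (intro ext)
    fix i k
    show "(U \<star> G) i k = mat_one I i k"
    proof (cases "k \<in> I")
      case True
      then obtain l where l: "l \<in> I" "k \<noteq> l" using other by blast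
      have "(U \<star> G) \<star> mat_unit k l = U \<star> (G \<star> mat_unit k l)"
        by (rule mat_mult_assoc_row_col[OF U_row_fin M_rcf_D(3)])
          (use mat_unit_in_M_fin[OF True l(1)] M_fin_subset_M_rcf in blast)
      also have "\<dots> = mat_unit k l" using G_unit[OF True l] by auto
      finally have "((U \<star> G) \<star> mat_unit k l) i l = mat_unit k l i l" by simp
      then show ?thesis
        using True by (simp add: mat_mult_unit mat_unit_apply) (simp add: outer_def unit_vec_def mat_one_def)
    next
      case False
      then show ?thesis using M_rcf_D(1)[OF M_rcf_mult_closed[OF U_rcf G_rcf], of i k]
        by (auto simp: mat_one_def)
    qed
  qed

  interpret rcf: Group.monoid "rcf_monoid I :: ('i, 'f) mat monoid" by (rule monoid_rcf_monoid)
  have carr: "U \<in> carrier (rcf_monoid I)" "G \<in> carrier (rcf_monoid I)"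
    using U_rcf G_rcf by (simp_all add: rcf_monoid_def)
  have inv: "G \<otimes>\<^bsub>rcf_monoid I\<^esub> U = \<one>\<^bsub>rcf_monoid I\<^esub>" "U \<otimes>\<^bsub>rcf_monoid I\<^esub> G = \<one>\<^bsub>rcf_monoid I\<^esub>"
    using GU UG by (simp_all add: rcf_monoid_def)
  have Gu: "G \<in> Units (rcf_monoid I)" using carr inv unfolding Units_def by blast
  have "inv\<^bsub>GL_rcf I\<^esub> G = U"
    unfolding GL_rcf_def rcf.units_of_inv[OF Gu] by (rule rcf.inv_unique'[OF carr(2,1) inv, symmetric])
  moreover have "G \<in> carrier (GL_rcf I)" using Gu by (simp add: GL_rcf_def units_of_carrier)
  ultimately show ?thesis using that \<phi>_eq by simp
qed

section \<open>The negative transpose\<close>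

lemma mat_transpose_mult: "mat_transpose (a \<star> b) = mat_transpose b \<star> mat_transpose a"
  by (simp add: mat_transpose_def mat_mult_def mult.commute)

lemma neg_transpose_bracket:
  "- mat_transpose (lie_bracket a b) = lie_bracket (- mat_transpose a) (- mat_transpose b)"
proof -
  have neg: "(- a) \<star> (- b) = a \<star> b" for a b :: "('a, 'b) mat"
    by (simp add: mat_mult_def)
  have "- mat_transpose (lie_bracket a b) = mat_transpose (b \<star> a) - mat_transpose (a \<star> b)"
    by (simp add: lie_bracket_def mat_transpose_def fun_eq_iff)
  then show ?thesis by (simp add: mat_transpose_mult lie_bracket_def neg)
qed

lemma neg_transpose_in_sl_inf:
  fixes a :: "('i, 'f::field) mat"
  assumes "a \<in> sl_inf I"
  shows "- mat_transpose a \<in> sl_inf I"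
proof -
  have fin: "- mat_transpose a \<in> M_fin I" if a: "a \<in> M_fin I" for a :: "('i, 'f) mat"
  proof (rule M_fin_I[where S = "prod.swap ` {(i, j). a i j \<noteq> 0}"])
    show "(i, j) \<in> prod.swap ` {(i, j). a i j \<noteq> 0}" if "(- mat_transpose a) i j \<noteq> 0" for i j
      using that by (force simp: mat_transpose_def image_iff)
  qed (use a in \<open>auto simp: M_fin_def\<close>)
  let ?B = "{lie_bracket a b | a b. a \<in> M_fin I \<and> b \<in> M_fin I} :: ('i, 'f) mat set"
  show ?thesis
  proof (rule linear_image_of_span[OF mat.subspace_UNIV subspace_sl_inf subset_UNIV,
        where B = ?B and f = "\<lambda>a. - mat_transpose a"])
    show "a \<in> mat.span ?B" using assms by (simp add: sl_inf_def)
    fix b assume "b \<in> ?B"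
    then obtain c d where cd: "b = lie_bracket c d" "c \<in> M_fin I" "d \<in> M_fin I" by blast
    show "- mat_transpose b \<in> sl_inf I"
      unfolding cd(1) neg_transpose_bracket by (intro lie_bracket_in_sl_inf fin cd)
  qed (auto simp: mat_transpose_def mat_scale_def fun_eq_iff)
qed

text \<open>
  Composition with the negative transpose turns an automorphism whose images of units multiply in
  reversed order into one for which they multiply in the original order.
\<close>

lemma automorphism_neg_transpose:
  fixes \<phi> :: "('i, 'f::field) mat \<Rightarrow> ('i, 'f) mat"
  assumes aut: "lie_automorphism (sl_inf I) \<phi>"
  shows "lie_automorphism (sl_inf I) (\<lambda>a. \<phi> (- mat_transpose a))"
  unfolding lie_automorphism_def
proof (intro conjI ballI allI)
  let ?n = "\<lambda>a :: ('i, 'f) mat. - mat_transpose a"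
  have "bij_betw ?n (sl_inf I) (sl_inf I)"
    by (rule bij_betwI[where g = ?n])
      (auto simp: neg_transpose_in_sl_inf, auto simp: mat_transpose_def fun_eq_iff)
  from bij_betw_trans[OF this automorphism_bij[OF aut]]
  show "bij_betw (\<lambda>a. \<phi> (?n a)) (sl_inf I) (sl_inf I)" by (simp add: comp_def)
  fix a b :: "('i, 'f) mat" and c
  assume a: "a \<in> sl_inf I"
  note na = neg_transpose_in_sl_inf[OF a]
  have "?n (mat_scale c a) = mat_scale c (?n a)"
    by (simp add: mat_transpose_def mat_scale_def fun_eq_iff)
  then show "\<phi> (?n (mat_scale c a)) = mat_scale c (\<phi> (?n a))"
    using automorphism_scale[OF aut na] by simp
  assume b: "b \<in> sl_inf I"
  note nb = neg_transpose_in_sl_inf[OF b]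
  have "?n (a + b) = ?n a + ?n b" by (simp add: mat_transpose_def fun_eq_iff)
  then show "\<phi> (?n (a + b)) = \<phi> (?n a) + \<phi> (?n b)"
    using automorphism_add[OF aut na nb] by simp
  show "\<phi> (?n (lie_bracket a b)) = lie_bracket (\<phi> (?n a)) (\<phi> (?n b))"
    unfolding neg_transpose_bracket by (rule automorphism_bracket[OF aut na nb])
qed

lemma same_col_scale: "same_col a b \<Longrightarrow> same_col (mat_scale c a) (mat_scale c b)"
  unfolding same_col_def using mat_scale_outer(2) by metis

theorem corollary2:
  fixes I :: "'i set" and \<phi> :: "('i, 'f::field) mat \<Rightarrow> ('i, 'f) mat"
  assumes "infinite I"
    and "lie_automorphism (sl_inf I) \<phi>"
  shows "\<exists>x \<in> carrier (GL_rcf I).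
     (\<forall>a \<in> sl_inf I. \<phi> a = inv\<^bsub>GL_rcf I\<^esub> x \<star> a \<star> x) \<or>
     (\<forall>a \<in> sl_inf I. \<phi> a = - (inv\<^bsub>GL_rcf I\<^esub> x \<star> mat_transpose a \<star> x))"
proof -
  note I = assms(1) and aut = assms(2)
  let ?T = "\<lambda>i j k. same_col (\<phi> (mat_unit i j)) (\<phi> (mat_unit i k))"
  let ?triple = "\<lambda>i j k. {i, j, k} \<subseteq> I \<and> distinct [i, j, k]"
  show ?thesis
  proof (cases "\<exists>i j k. ?triple i j k \<and> ?T i j k")
    case True
    then have "?T i j k" if "{i, j, k} \<subseteq> I" "distinct [i, j, k]" for i j k
      using image_unit_type[OF I aut that] by blast
    then obtain u g where "\<And>i j. i \<in> I \<Longrightarrow> j \<in> I \<Longrightarrow> i \<noteq> j \<Longrightarrow> \<phi> (mat_unit i j) = outer (u i) (g j)"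
      using image_units_in_coordinates[OF I aut] by metis
    from dual_bases_conjugation[OF I aut this] show ?thesis by metis
  next
    case False
    let ?\<psi> = "\<lambda>a. \<phi> (- mat_transpose a)"
    have aut': "lie_automorphism (sl_inf I) ?\<psi>" by (rule automorphism_neg_transpose[OF aut])
    have unit: "?\<psi> (mat_unit i j) = mat_scale (-1) (\<phi> (mat_unit j i))" if "i \<in> I" "j \<in> I" "i \<noteq> j" for i j
    proof -
      have "- mat_transpose (mat_unit i j) = (mat_scale (-1) (mat_unit j i) :: ('i, 'f) mat)"
        by (auto simp: mat_transpose_def mat_unit_apply mat_scale_def fun_eq_iff)
      then show ?thesis using automorphism_scale[OF aut mat_unit_in_sl_inf] that by metis
    qed
    have "same_col (?\<psi> (mat_unit i j)) (?\<psi> (mat_unit i k))"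
      if ijk: "{i, j, k} \<subseteq> I" "distinct [i, j, k]" for i j k
    proof -
      \<comment> \<open>The units \<open>E i j\<close> and \<open>E i k\<close> become \<open>- E j i\<close> and \<open>- E k i\<close>, two sides of the triple \<open>j, k, i\<close>.\<close>
      have "\<not> ?T j k i" using False ijk by auto
      then have "same_col (\<phi> (mat_unit j i)) (\<phi> (mat_unit k i))"
        using image_unit_triangle[OF I aut, of j k i] ijk by (auto intro: same_col_sym)
      moreover have "i \<in> I" "j \<in> I" "k \<in> I" "i \<noteq> j" "i \<noteq> k" using ijk by auto
      ultimately show ?thesis by (simp only: unit not_False_eq_True same_col_scale)
    qed
    then obtain u g where "\<And>i j. i \<in> I \<Longrightarrow> j \<in> I \<Longrightarrow> i \<noteq> j \<Longrightarrow> ?\<psi> (mat_unit i j) = outer (u i) (g j)"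
      using image_units_in_coordinates[OF I aut'] by metis
    then obtain x where x: "x \<in> carrier (GL_rcf I)"
      "\<And>a. a \<in> sl_inf I \<Longrightarrow> ?\<psi> a = inv\<^bsub>GL_rcf I\<^esub> x \<star> a \<star> x"
      using dual_bases_conjugation[OF I aut'] by metis
    have "\<phi> a = - (inv\<^bsub>GL_rcf I\<^esub> x \<star> mat_transpose a \<star> x)" if "a \<in> sl_inf I" for a
    proof -
      have neg: "- b = mat_scale (-1) b" for b :: "('i, 'f) mat"
        by (simp add: mat_scale_def fun_eq_iff)
      have "\<phi> a = ?\<psi> (- mat_transpose a)" by (simp add: mat_transpose_def fun_Compl_def)
      also have "\<dots> = inv\<^bsub>GL_rcf I\<^esub> x \<star> (- mat_transpose a) \<star> x"
        by (rule x(2)[OF neg_transpose_in_sl_inf[OF that]])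
      finally show ?thesis unfolding neg mat_mult_scale .
    qed
    then show ?thesis using x(1) by blast
  qed
qed

end
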